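(* Fix an integer $n\ge 1$. There is a constant $C_n>0$ such that for every prime $p$ with $p\nmid n$, the proportion $I_{n,p}$ of monic degree-$n$ polynomials in $\mathbb{Z}_p[x]$ that are irreducible satisfies $$\left|I_{n,p}-\frac1n\right|\le C_n\,p^{-n/2}.$$ That is, $I_{n,p}=\frac1n+O(p^{-n/2})$ as $p\to\infty$.
   Context: A monic degree-$n$ polynomial $x^n+c_{n-1}x^{n-1}+\cdots+c_1x+c_0\in\mathbb{Z}_p[x]$ is identified with the point $(c_{n-1},\dots,c_0)\in\mathbb{Z}_p^n$, and $\mathbb{Z}_p^n$ carries the normalized Haar measure $\mu$ with $\mu(\mathbb{Z}_p^n)=1$. A polynomial is irreducible if it cannot be written as a product of two nonconstant polynomials in $\mathbb{Z}_p[x]$. The proportion of irreducible polynomials is the Haar measure of the set of irreducible monic degree-$n$ polynomials. *)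

theory Defs
  imports "HOL-Probability.Probability" "HOL-Computational_Algebra.Primes"
begin

text \<open>The p-adic integers Z_p, realised as compatible sequences of residues:
  x k is the residue of x modulo p^k, taken in {0..<p^k}.\<close>
definition Zp :: "nat \<Rightarrow> (nat \<Rightarrow> int) set" where
  "Zp p = {x. \<forall>k. 0 \<le> x k \<and> x k < int p ^ k \<and> x (Suc k) mod int p ^ k = x k}"

definition zp_zero :: "nat \<Rightarrow> int" where
  "zp_zero = (\<lambda>k. 0)"

definition zp_one :: "nat \<Rightarrow> nat \<Rightarrow> int" where
  "zp_one p = (\<lambda>k. 1 mod int p ^ k)"

definition zp_of_digits :: "nat \<Rightarrow> (nat \<Rightarrow> nat) \<Rightarrow> nat \<Rightarrow> int" where
  "zp_of_digits p d = (\<lambda>k. \<Sum>i<k. int (d i) * int p ^ i)"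

definition haar_Zp :: "nat \<Rightarrow> (nat \<Rightarrow> int) measure" where
  "haar_Zp p = distr (PiM UNIV (\<lambda>_::nat. uniform_count_measure {0..<p}))
                     (restrict_space (PiM UNIV (\<lambda>_::nat. count_space (UNIV::int set))) (Zp p))
                     (zp_of_digits p)"

text \<open>Polynomials over Z_p: coefficient sequences (coefficient of x^i at index i)
  with values in Z_p and finite support.\<close>
definition zp_poly :: "nat \<Rightarrow> (nat \<Rightarrow> nat \<Rightarrow> int) \<Rightarrow> bool" where
  "zp_poly p g \<longleftrightarrow> (\<forall>i. g i \<in> Zp p) \<and> (\<exists>N. \<forall>i>N. g i = zp_zero)"

definition zp_nonconstant :: "(nat \<Rightarrow> nat \<Rightarrow> int) \<Rightarrow> bool" where
  "zp_nonconstant g \<longleftrightarrow> (\<exists>i\<ge>1. g i \<noteq> zp_zero)"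

definition zp_polymul :: "nat \<Rightarrow> (nat \<Rightarrow> nat \<Rightarrow> int) \<Rightarrow> (nat \<Rightarrow> nat \<Rightarrow> int) \<Rightarrow> nat \<Rightarrow> nat \<Rightarrow> int" where
  "zp_polymul p g h = (\<lambda>j k. (\<Sum>i\<le>j. g i k * h (j - i) k) mod int p ^ k)"

definition zp_irreducible :: "nat \<Rightarrow> (nat \<Rightarrow> nat \<Rightarrow> int) \<Rightarrow> bool" where
  "zp_irreducible p f \<longleftrightarrow>
     \<not> (\<exists>g h. zp_poly p g \<and> zp_poly p h \<and> zp_nonconstant g \<and> zp_nonconstant h
              \<and> f = zp_polymul p g h)"

definition monic_poly :: "nat \<Rightarrow> nat \<Rightarrow> (nat \<Rightarrow> nat \<Rightarrow> int) \<Rightarrow> nat \<Rightarrow> nat \<Rightarrow> int" where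
  "monic_poly p n c = (\<lambda>i. if i < n then c i else if i = n then zp_one p else zp_zero)"

definition haar_Zp_n :: "nat \<Rightarrow> nat \<Rightarrow> (nat \<Rightarrow> nat \<Rightarrow> int) measure" where
  "haar_Zp_n p n = PiM {..<n} (\<lambda>_. haar_Zp p)"

definition irred_proportion :: "nat \<Rightarrow> nat \<Rightarrow> real" where
  "irred_proportion n p =
     measure (haar_Zp_n p n) {c \<in> space (haar_Zp_n p n). zp_irreducible p (monic_poly p n c)}"

end

theory Submission
  imports Defs "HOL-Computational_Algebra.Polynomial"
begin

text \<open>
  Let \<open>N\<close> be the number of monic irreducible polynomials of degree \<open>n\<close> over \<open>F\<^sub>p\<close>. A monic polynomial over
  \<open>Z\<^sub>p\<close> with irreducible residue is irreducible, and by Hensel's lemma an irreducible one has a power of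
  an irreducible polynomial as its residue. There are at most \<open>n p\<^bsup>n/2\<^esup>\<close> proper such powers of degree \<open>n\<close>,
  and each residue class has measure \<open>p\<^bsup>-n\<^esup>\<close>, so the proportion is \<open>N / p\<^sup>n\<close> up to an error \<open>n p\<^bsup>-n/2\<^esup>\<close>.
  Unique factorisation gives \<open>\<Sum> deg P = p\<^sup>n\<close>, summed over the powers \<open>P\<^sup>k\<close> of degree \<open>n\<close>; the terms with
  \<open>k \<ge> 2\<close> contribute at most \<open>n\<^sup>2 p\<^bsup>n/2\<^esup>\<close>, so \<open>n N = p\<^sup>n + O(p\<^bsup>n/2\<^esup>)\<close>. Measurability of the set of irreducible
  polynomials follows by compactness: reducibility is detected by factorisations modulo all \<open>p\<^sup>k\<close>.
\<close>

section \<open>Polynomials modulo a prime\<close>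

text \<open>There is no type of residues modulo a variable prime \<open>p\<close>, so \<open>F\<^sub>p[x]\<close> is modelled by integer
  polynomials up to coefficientwise congruence; \<open>monics p n\<close> below collects the canonical
  representatives of the monic residue classes of degree \<open>n\<close>.\<close>

definition pcong :: "int \<Rightarrow> int poly \<Rightarrow> int poly \<Rightarrow> bool" where
  "pcong m f g \<longleftrightarrow> [:m:] dvd f - g"

lemma pcong_iff_coeff: "pcong m f g \<longleftrightarrow> (\<forall>i. coeff f i mod m = coeff g i mod m)"
  unfolding pcong_def const_poly_dvd_iff by (simp add: mod_eq_dvd_iff)

lemma pcong_refl [simp]: "pcong m f f"
  by (simp add: pcong_def)

lemma pcong_sym: "pcong m f g \<Longrightarrow> pcong m g f"
  by (simp add: pcong_iff_coeff)

lemma pcong_trans [trans]: "pcong m f g \<Longrightarrow> pcong m g h \<Longrightarrow> pcong m f h"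
  by (simp add: pcong_iff_coeff)

lemma pcong_add: "pcong m f g \<Longrightarrow> pcong m f' g' \<Longrightarrow> pcong m (f + f') (g + g')"
  unfolding pcong_def by (metis add_diff_add dvd_add)

lemma pcong_mult:
  assumes "pcong m f g" "pcong m f' g'"
  shows "pcong m (f * f') (g * g')"
proof -
  have "f * f' - g * g' = (f - g) * f' + g * (f' - g')"
    by (simp add: algebra_simps)
  then show ?thesis
    using assms unfolding pcong_def by (metis dvd_add dvd_mult dvd_mult2)
qed

lemma pcong_mult_left: "pcong m f g \<Longrightarrow> pcong m (h * f) (h * g)"
  by (simp add: pcong_mult)

lemma pcong_mod_dvd: "pcong m f g \<Longrightarrow> d dvd m \<Longrightarrow> pcong d f g"
  unfolding pcong_def const_poly_dvd_iff by (meson dvd_trans)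

definition reduce_poly :: "int \<Rightarrow> int poly \<Rightarrow> int poly" where
  "reduce_poly m = map_poly (\<lambda>x. x mod m)"

lemma coeff_reduce_poly [simp]: "coeff (reduce_poly m f) i = coeff f i mod m"
  by (simp add: reduce_poly_def coeff_map_poly)

lemma pcong_reduce_poly: "pcong m f (reduce_poly m f)"
  by (simp add: pcong_iff_coeff)

lemma degree_reduce_poly_le: "degree (reduce_poly m f) \<le> degree f"
  by (rule degree_le) (simp add: coeff_eq_0)

text \<open>A leading coefficient divisible by \<open>m\<close> would, being its own residue, be 0.
  So the degree of a reduced integer polynomial is its degree modulo \<open>m\<close>.\<close>

lemma reduce_poly_not_dvd_lead:
  assumes "reduce_poly m f \<noteq> 0" shows "\<not> m dvd lead_coeff (reduce_poly m f)"
proof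
  assume "m dvd lead_coeff (reduce_poly m f)"
  then have "lead_coeff (reduce_poly m f) = 0" by (metis coeff_reduce_poly dvd_imp_mod_0 mod_mod_trivial)
  with assms show False by (simp only: leading_coeff_0_iff)
qed

lemma pcong_degree_le:
  assumes "pcong m f g" "\<not> m dvd lead_coeff f"
  shows "degree f \<le> degree g"
proof (rule ccontr)
  assume "\<not> ?thesis"
  then have "coeff g (degree f) = 0" by (simp add: coeff_eq_0)
  with assms(1) have "lead_coeff f mod m = 0"
    by (metis mod_0 pcong_iff_coeff)
  with assms(2) show False by auto
qed

section \<open>Divisibility, coprimality and irreducibility modulo p\<close>

definition monics :: "nat \<Rightarrow> nat \<Rightarrow> int poly set" where
  "monics p n = {f. degree f = n \<and> lead_coeff f = 1 \<and> (\<forall>i. 0 \<le> coeff f i \<and> coeff f i < int p)}"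

text \<open>The cofactor is any integer polynomial, so its degree may exceed its degree modulo
  \<open>p\<close>; between monic polynomials \<open>mdvd_monicE\<close> supplies a monic
  cofactor.\<close>

definition mdvd :: "nat \<Rightarrow> int poly \<Rightarrow> int poly \<Rightarrow> bool" where
  "mdvd p f g \<longleftrightarrow> (\<exists>h. pcong (int p) g (f * h))"

text \<open>Coprimality is encoded as a Bezout relation because Euclid's lemma and Hensel lifting
  both consume the coefficients \<open>s\<close> and \<open>t\<close>.\<close>

definition mcoprime :: "nat \<Rightarrow> int poly \<Rightarrow> int poly \<Rightarrow> bool" where
  "mcoprime p f g \<longleftrightarrow> (\<exists>s t. pcong (int p) (s * f + t * g) 1)"

text \<open>Testing monic factors suffices over a field, where factors can be rescaled, and for them
  the integer degree equals the degree modulo \<open>p\<close>.\<close>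

definition mirred :: "nat \<Rightarrow> int poly \<Rightarrow> bool" where
  "mirred p f \<longleftrightarrow> lead_coeff f = 1 \<and> degree f \<ge> 1 \<and>
     (\<forall>g h. lead_coeff g = 1 \<longrightarrow> lead_coeff h = 1 \<longrightarrow> pcong (int p) f (g * h) \<longrightarrow> degree g = 0 \<or> degree h = 0)"

lemma mirredD:
  assumes "mirred p f" "pcong (int p) f (g * h)" "lead_coeff g = 1" "lead_coeff h = 1"
  shows "degree g = 0 \<or> degree h = 0"
  using assms(1)[unfolded mirred_def, THEN conjunct2, THEN conjunct2, rule_format, OF assms(3,4,2)] .

text \<open>Canonical representatives list each monic irreducible of F_p[x] exactly once, so that
  \<open>card\<close> counts them.\<close>

definition irreds :: "nat \<Rightarrow> int poly set" where
  "irreds p = {f. f \<in> monics p (degree f) \<and> mirred p f}"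

lemma monic_degree_0: "lead_coeff f = 1 \<Longrightarrow> degree f = 0 \<Longrightarrow> f = (1 :: int poly)"
  by (metis degree_eq_zeroE lead_coeff_pCons(2) one_pCons)

lemma lead_coeff_monic_mult:
  "lead_coeff f = 1 \<Longrightarrow> lead_coeff g = (1::int) \<Longrightarrow> lead_coeff (f * g) = 1"
  by (simp add: lead_coeff_mult)

lemma degree_monic_mult:
  fixes f :: "int poly"
  shows "lead_coeff f = 1 \<Longrightarrow> g \<noteq> 0 \<Longrightarrow> degree (f * g) = degree f + degree g"
  by (rule degree_mult_eq) auto

lemma lead_coeff_monic_power: "lead_coeff f = 1 \<Longrightarrow> lead_coeff (f ^ k) = (1::int)"
  by (simp add: lead_coeff_power)

text \<open>Pseudo-division scales the dividend by a power of the leading coefficient of the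
  divisor, which is 1 here.\<close>

lemma monic_divmod:
  fixes f g :: "int poly"
  assumes "lead_coeff g = 1"
  obtains q r where "f = g * q + r" "r = 0 \<or> degree r < degree g"
proof -
  obtain q r where qr: "pseudo_divmod f g = (q, r)" by fastforce
  have "g \<noteq> 0" using assms by auto
  from pseudo_divmod[OF this qr] show ?thesis using assms that by auto
qed

lemma mdvdI: "pcong (int p) g (f * h) \<Longrightarrow> mdvd p f g"
  unfolding mdvd_def by blast

lemma mdvd_refl [simp]: "mdvd p f f"
  by (rule mdvdI[of _ _ _ 1]) simp

lemma mdvd_mult: "mdvd p f g \<Longrightarrow> mdvd p f (h * g)"
  unfolding mdvd_def by (metis mult.left_commute pcong_mult_left)

lemma mdvd_add: "mdvd p f g \<Longrightarrow> mdvd p f h \<Longrightarrow> mdvd p f (g + h)"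
  unfolding mdvd_def by (metis distrib_left pcong_add)

lemma mdvd_cong: "pcong (int p) g h \<Longrightarrow> mdvd p f g \<Longrightarrow> mdvd p f h"
  unfolding mdvd_def by (meson pcong_sym pcong_trans)

lemma mdvd_cong_left: "pcong (int p) f g \<Longrightarrow> mdvd p f h \<Longrightarrow> mdvd p g h"
  unfolding mdvd_def by (metis pcong_mult pcong_refl pcong_trans)

lemma mdvd_trans: "mdvd p f g \<Longrightarrow> mdvd p g h \<Longrightarrow> mdvd p f h"
  unfolding mdvd_def by (metis mult.assoc pcong_mult pcong_refl pcong_trans)

text \<open>Euclid's lemma: multiplying the Bezout relation by \<open>h\<close> gives two terms, one
  containing \<open>f\<close> and the other \<open>g * h\<close>.\<close>

lemma mdvd_coprime:
  assumes "mcoprime p f g" "mdvd p f (g * h)"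
  shows "mdvd p f h"
proof -
  obtain s t where st: "pcong (int p) (s * f + t * g) 1"
    using assms(1) unfolding mcoprime_def by blast
  have "mdvd p f (h * s * f)" by (intro mdvd_mult mdvd_refl)
  moreover have "mdvd p f (t * (g * h))" by (intro mdvd_mult assms)
  ultimately have "mdvd p f (h * s * f + t * (g * h))" by (rule mdvd_add)
  also have "h * s * f + t * (g * h) = h * (s * f + t * g)" by (simp add: algebra_simps)
  finally show ?thesis
    using mdvd_cong[OF pcong_mult_left[OF st]] by (metis mult.right_neutral)
qed

text \<open>Multiply the Bezout relations for \<open>f\<close> and \<open>f ^ k\<close>: the only
  product term without a factor \<open>g\<close> is a multiple of \<open>f ^ Suc k\<close>.\<close>

lemma mcoprime_power:
  assumes "mcoprime p f g" shows "mcoprime p (f ^ k) g"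
proof (induction k)
  case 0
  have "pcong (int p) (1 * f ^ 0 + 0 * g) 1" by simp
  then show ?case unfolding mcoprime_def by blast
next
  case (Suc k)
  obtain s t s' t' where "pcong (int p) (s * f + t * g) 1" "pcong (int p) (s' * f ^ k + t' * g) 1"
    using assms Suc unfolding mcoprime_def by blast
  from pcong_mult[OF this]
  have "pcong (int p) ((s * s') * f ^ Suc k + (s * f * t' + t * s' * f ^ k + t * t' * g) * g) 1"
    by (simp add: algebra_simps)
  then show ?case unfolding mcoprime_def by blast
qed

lemma monic_add_lower:
  fixes g :: "int poly"
  assumes "lead_coeff g = 1" "u = 0 \<or> degree u < degree g"
  shows "lead_coeff (g + smult c u) = 1" "degree (g + smult c u) = degree g"
proof -
  have "degree (g + smult c u) = degree g \<and> lead_coeff (g + smult c u) = 1"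
  proof (cases "u = 0")
    case False
    then have "degree (smult c u) < degree g"
      using assms(2) degree_smult_le[of c u] by linarith
    moreover have "coeff u (degree g) = 0" using assms(2) False by (simp add: coeff_eq_0)
    ultimately show ?thesis
      using assms(1) by (simp add: degree_add_eq_left)
  qed (use assms in auto)
  then show "lead_coeff (g + smult c u) = 1" "degree (g + smult c u) = degree g" by auto
qed

lemma mcoprime_cong:
  assumes "mcoprime p f g" "pcong (int p) f f'" "pcong (int p) g g'"
  shows "mcoprime p f' g'"
proof -
  obtain s t where "pcong (int p) (s * f + t * g) 1" using assms(1) unfolding mcoprime_def by blast
  moreover have "pcong (int p) (s * f + t * g) (s * f' + t * g')"
    by (intro pcong_add pcong_mult_left assms)
  ultimately show ?thesis unfolding mcoprime_def by (meson pcong_sym pcong_trans)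
qed

lemma irreds_monic: "P \<in> irreds p \<Longrightarrow> lead_coeff P = 1"
  by (simp add: irreds_def mirred_def)

lemma irreds_degree: "P \<in> irreds p \<Longrightarrow> degree P \<ge> 1"
  by (simp add: irreds_def mirred_def)

lemma irreds_in_monics: "P \<in> irreds p \<Longrightarrow> P \<in> monics p (degree P)"
  by (simp add: irreds_def)

lemma degree_irred_power:
  "P \<in> irreds p \<Longrightarrow> degree (P ^ k) = k * degree P"
  using irreds_monic by (metis degree_power_eq leading_coeff_0_iff zero_neq_one)

section \<open>Arithmetic of F_p[x] for a prime p\<close>

locale prime_modulus =
  fixes p :: nat
  assumes prime_p: "prime p"
begin

lemma p_gt_1: "int p > 1"
  using prime_gt_1_nat[OF prime_p] by simp

lemma not_p_dvd_1: "\<not> int p dvd 1"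
  using p_gt_1 by auto

lemma pcong_monic_degree:
  assumes "pcong (int p) f g" "lead_coeff f = 1" "lead_coeff g = 1"
  shows "degree f = degree g"
  by (intro antisym pcong_degree_le[of "int p"]) (use assms not_p_dvd_1 pcong_sym in auto)

lemma monics_eqI:
  assumes "pcong (int p) f g" "f \<in> monics p m" "g \<in> monics p n"
  shows "f = g"
proof (rule poly_eqI)
  fix i
  have "coeff f i mod int p = coeff g i mod int p" using assms(1) by (simp add: pcong_iff_coeff)
  then show "coeff f i = coeff g i" using assms(2,3) by (auto simp: monics_def)
qed

lemma reduce_poly_monic:
  assumes "lead_coeff f = 1" shows "reduce_poly (int p) f \<in> monics p (degree f)"
proof -
  have "coeff (reduce_poly (int p) f) (degree f) = 1" using assms p_gt_1 by simp
  then have "degree (reduce_poly (int p) f) = degree f"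
    by (metis antisym degree_reduce_poly_le le_degree zero_neq_one)
  then show ?thesis using assms p_gt_1 by (auto simp: monics_def)
qed

text \<open>The constant \<open>p\<close> is a prime element of the integer polynomial ring and does
  not divide a monic polynomial. This stands in for F_p[x] being an integral domain.\<close>

lemma pcong_mult_cancel:
  assumes "pcong (int p) (f * g) (f * h)" "lead_coeff f = 1"
  shows "pcong (int p) g h"
proof -
  have "prime_elem [:int p:]"
    using prime_p by (intro lift_prime_elem_poly) (auto simp: prime_elem_iff_prime_abs)
  moreover have "[:int p:] dvd f * (g - h)"
    using assms(1) by (simp add: pcong_def algebra_simps)
  moreover have "\<not> [:int p:] dvd f"
    using assms(2) not_p_dvd_1 unfolding const_poly_dvd_iff by metis
  ultimately show ?thesis unfolding pcong_def by (metis prime_elem_dvd_mult_iff)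
qed

text \<open>Once the cofactor is reduced, its leading coefficient is nonzero modulo
  \<open>p\<close>, so \<open>f * h\<close> and \<open>g\<close> have equal degrees. Comparing top
  coefficients makes it congruent to 1, and reducedness makes it equal to 1.\<close>

lemma mdvd_monicE:
  assumes "mdvd p f g" "lead_coeff f = 1" "lead_coeff g = 1"
  obtains h where "pcong (int p) g (f * h)" "lead_coeff h = 1" "degree g = degree f + degree h"
proof -
  obtain h0 where h0: "pcong (int p) g (f * h0)" using assms(1) unfolding mdvd_def by blast
  define h where "h = reduce_poly (int p) h0"
  have h: "pcong (int p) g (f * h)"
    unfolding h_def by (rule pcong_trans[OF h0]) (intro pcong_mult_left pcong_reduce_poly)
  have "h \<noteq> 0"
  proof
    assume "h = 0"
    with h have "lead_coeff g mod int p = 0" by (simp add: pcong_iff_coeff)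
    with assms(3) not_p_dvd_1 show False by (metis mod_0_imp_dvd)
  qed
  have lc: "lead_coeff (f * h) = lead_coeff h" using assms(2) by (simp add: lead_coeff_mult)
  have "degree g = degree (f * h)"
    using reduce_poly_not_dvd_lead[of "int p" h0] \<open>h \<noteq> 0\<close> lc h assms(3) not_p_dvd_1
    by (intro antisym pcong_degree_le[of "int p"]) (auto simp: h_def intro: pcong_sym)
  then have "lead_coeff h mod int p = 1 mod int p"
    using h lc assms(3) by (metis pcong_iff_coeff)
  then have "lead_coeff h = 1" using p_gt_1 by (simp add: h_def)
  then show ?thesis
    using that[OF h] degree_monic_mult[OF assms(2) \<open>h \<noteq> 0\<close>] \<open>degree g = _\<close> by simp
qed

text \<open>A monic element of least degree divides everything modulo \<open>p\<close>, since a nonzero remainder could be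
  reduced and rescaled to a monic element of smaller degree.\<close>

lemma ideal_monic_generator:
  assumes add: "\<And>f g. f \<in> I \<Longrightarrow> g \<in> I \<Longrightarrow> f + g \<in> I"
    and mult: "\<And>f g. f \<in> I \<Longrightarrow> g * f \<in> I"
    and cong: "\<And>f g. f \<in> I \<Longrightarrow> pcong (int p) f g \<Longrightarrow> g \<in> I"
    and ex: "f0 \<in> I" "lead_coeff f0 = 1"
  obtains d where "d \<in> I" "lead_coeff d = 1" "\<And>f. f \<in> I \<Longrightarrow> mdvd p d f"
proof -
  obtain d where d: "d \<in> I" "lead_coeff d = 1"
    and least: "\<And>e. e \<in> I \<Longrightarrow> lead_coeff e = 1 \<Longrightarrow> degree d \<le> degree e"
    using ex_has_least_nat[of "\<lambda>e. e \<in> I \<and> lead_coeff e = 1" f0 degree] ex by blast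
  have "mdvd p d f" if f: "f \<in> I" for f
  proof -
    obtain q r where qr: "f = d * q + r" "r = 0 \<or> degree r < degree d"
      using monic_divmod[OF d(2)] .
    have "r = f + (- q) * d" using qr(1) by (simp add: algebra_simps)
    then have "r \<in> I" using add mult f d(1) by metis
    define r' where "r' = reduce_poly (int p) r"
    have r'I: "r' \<in> I" unfolding r'_def by (rule cong[OF \<open>r \<in> I\<close> pcong_reduce_poly])
    have "r' = 0"
    proof (rule ccontr)
      assume nz: "r' \<noteq> 0"
      then have "\<not> int p dvd lead_coeff r'" unfolding r'_def by (rule reduce_poly_not_dvd_lead)
      then have "coprime (lead_coeff r') (int p)"
        using prime_p by (metis coprime_commute prime_imp_coprime prime_nat_int_transfer)
      then obtain u v where "u * lead_coeff r' + v * int p = 1"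
        using bezout_int[of "lead_coeff r'" "int p"] by (auto simp: coprime_iff_gcd_eq_1)
      then have u: "lead_coeff r' * u mod int p = 1 mod int p"
        by (metis mod_mult_self1 mult.commute)
      define e where "e = reduce_poly (int p) (smult u r')"
      have "e \<in> I"
        unfolding e_def using cong[OF mult[OF r'I, of "[:u:]"] pcong_reduce_poly] by simp
      have ce: "coeff e (degree r') = 1"
        using u p_gt_1 by (simp add: e_def mult.commute)
      have "degree e \<le> degree r'"
        unfolding e_def by (meson degree_reduce_poly_le degree_smult_le order_trans)
      then have "degree e = degree r'" using ce by (simp add: antisym le_degree)
      then have "degree d \<le> degree r'" using least[OF \<open>e \<in> I\<close>] ce by simp
      also have "\<dots> \<le> degree r" unfolding r'_def by (rule degree_reduce_poly_le)
      finally show False using qr(2) nz by (auto simp: r'_def reduce_poly_def)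
    qed
    then have "pcong (int p) r 0" using pcong_reduce_poly[of "int p" r] by (simp add: r'_def)
    then have "pcong (int p) f (d * q)"
      using pcong_add[of "int p" "d * q" "d * q" r 0] qr(1) by simp
    then show ?thesis by (rule mdvdI)
  qed
  with d show ?thesis using that by blast
qed

text \<open>The monic generator \<open>d\<close> of the ideal spanned by \<open>P\<close> and
  \<open>f\<close> modulo \<open>p\<close> divides \<open>P\<close>. With a constant cofactor,
  \<open>d\<close> would be congruent to \<open>P\<close> and \<open>P\<close> would divide
  \<open>f\<close>; so irreducibility forces \<open>d = 1\<close>, which is a Bezout
  relation.\<close>

lemma mirred_coprime:
  assumes P: "mirred p P" and ndvd: "\<not> mdvd p P f"
  shows "mcoprime p P f"
proof -
  define I where "I = {e. \<exists>s t. pcong (int p) (s * P + t * f) e}"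
  have monP: "lead_coeff P = 1" using P by (simp add: mirred_def)
  have PI: "P \<in> I"
    unfolding I_def by (rule CollectI, rule exI[of _ 1], rule exI[of _ 0]) simp
  have fI: "f \<in> I"
    unfolding I_def by (rule CollectI, rule exI[of _ 0], rule exI[of _ 1]) simp
  obtain d where d: "d \<in> I" "lead_coeff d = 1" "\<And>g. g \<in> I \<Longrightarrow> mdvd p d g"
  proof (rule ideal_monic_generator[of I P])
    fix g h assume "g \<in> I" "h \<in> I"
    then obtain s t s' t' where "pcong (int p) (s * P + t * f) g" "pcong (int p) (s' * P + t' * f) h"
      unfolding I_def by blast
    from pcong_add[OF this] have "pcong (int p) ((s + s') * P + (t + t') * f) (g + h)"
      by (simp add: algebra_simps)
    then show "g + h \<in> I" unfolding I_def by blast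
  next
    fix g h assume "g \<in> I"
    then obtain s t where "pcong (int p) (s * P + t * f) g" unfolding I_def by blast
    from pcong_mult_left[OF this, of h]
    have "pcong (int p) ((h * s) * P + (h * t) * f) (h * g)" by (simp add: algebra_simps)
    then show "h * g \<in> I" unfolding I_def by blast
  next
    fix g h assume "g \<in> I" "pcong (int p) g h"
    then show "h \<in> I" unfolding I_def using pcong_trans by blast
  qed (use PI monP in auto)
  obtain h where h: "pcong (int p) P (d * h)" "lead_coeff h = 1"
    using mdvd_monicE[OF d(3)[OF PI] d(2) monP] by blast
  have "degree h \<noteq> 0"
  proof
    assume "degree h = 0"
    then have "h = 1" using h(2) monic_degree_0 by blast
    then have "pcong (int p) d P" using h(1) by (simp add: pcong_sym)
    with d(3)[OF fI] ndvd show False using mdvd_cong_left by blast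
  qed
  then have "degree d = 0" using mirredD[OF P h(1) d(2) h(2)] by simp
  then have "d = 1" using d(2) monic_degree_0 by blast
  with d(1) show ?thesis unfolding I_def mcoprime_def by blast
qed

lemma mirred_cong:
  assumes "mirred p f" "pcong (int p) f g" "lead_coeff g = 1"
  shows "mirred p g"
  using assms(1,3) pcong_monic_degree[OF assms(2)] pcong_trans[OF assms(2)]
  unfolding mirred_def by auto

text \<open>A nonconstant monic divisor of least degree is irreducible, since its own factors divide
  \<open>f\<close> as well.\<close>

lemma exists_irred_divisor:
  assumes "lead_coeff f = 1" "degree f \<ge> 1"
  obtains P where "P \<in> irreds p" "mdvd p P f"
proof -
  obtain Q where Q: "lead_coeff Q = 1" "degree Q \<ge> 1" "mdvd p Q f"
    and least: "\<And>e. lead_coeff e = 1 \<Longrightarrow> degree e \<ge> 1 \<Longrightarrow> mdvd p e f \<Longrightarrow> degree Q \<le> degree e"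
    using ex_has_least_nat[of "\<lambda>e. lead_coeff e = 1 \<and> degree e \<ge> 1 \<and> mdvd p e f" f degree]
      assms mdvd_refl by blast
  have "mirred p Q"
    unfolding mirred_def
  proof (intro conjI Q allI impI)
    fix g h assume gh: "lead_coeff g = 1" "lead_coeff h = 1" "pcong (int p) Q (g * h)"
    have deg: "degree Q = degree g + degree h"
      using pcong_monic_degree[OF gh(3) Q(1) lead_coeff_monic_mult[OF gh(1,2)]]
        degree_monic_mult[OF gh(1), of h] gh(2) by fastforce
    have "mdvd p g f" using mdvd_trans[OF mdvdI[OF gh(3)] Q(3)] .
    then have "degree g \<ge> 1 \<Longrightarrow> degree Q \<le> degree g" using least gh(1) by blast
    then show "degree g = 0 \<or> degree h = 0" using deg by linarith
  qed
  define P where "P = reduce_poly (int p) Q"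
  have "P \<in> monics p (degree Q)" unfolding P_def by (rule reduce_poly_monic[OF Q(1)])
  then have "P \<in> irreds p"
    using mirred_cong[OF \<open>mirred p Q\<close>, of P] pcong_reduce_poly[of "int p" Q]
    by (auto simp: irreds_def monics_def P_def)
  moreover have "mdvd p P f" using mdvd_cong_left[OF pcong_reduce_poly Q(3)] by (simp add: P_def)
  ultimately show ?thesis using that by blast
qed

section \<open>Prime power divisors and unique factorisation\<close>

lemma irreds_mdvd_eq:
  assumes "P \<in> irreds p" "Q \<in> irreds p" "mdvd p P Q"
  shows "P = Q"
proof -
  obtain h where h: "pcong (int p) Q (P * h)" "lead_coeff h = 1"
    using mdvd_monicE[OF assms(3)] assms(1,2)[THEN irreds_monic] by blast
  then have "degree h = 0"
    using mirredD[of p Q P h] assms(2) irreds_monic[OF assms(1)] irreds_degree[OF assms(1)]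
    by (auto simp: irreds_def)
  then have "pcong (int p) Q P" using h monic_degree_0 by fastforce
  then show ?thesis using assms monics_eqI unfolding irreds_def by blast
qed

text \<open>For monic \<open>f\<close>, a prime factor of multiplicity m contributes the m pairs
  with exponents 1 to m, so this set encodes the multiset of prime factors.\<close>

definition prime_power_divisors :: "int poly \<Rightarrow> (int poly \<times> nat) set" where
  "prime_power_divisors f = {(P, k). P \<in> irreds p \<and> k \<ge> 1 \<and> mdvd p (P ^ k) f}"

lemma prime_power_divisors_degree:
  assumes "(P, k) \<in> prime_power_divisors f" "lead_coeff f = 1"
  shows "k * degree P \<le> degree f"
proof -
  have "P \<in> irreds p" "mdvd p (P ^ k) f" using assms by (auto simp: prime_power_divisors_def)
  then show ?thesis
    using mdvd_monicE[of "P ^ k" f] assms(2) lead_coeff_monic_power[OF irreds_monic]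
      degree_irred_power[of P p k] by (metis le_add1)
qed

text \<open>Cancelling one factor \<open>P0\<close> shows that its pairs move up by one exponent,
  with \<open>(P0, 1)\<close> filling the gap. Powers of any other irreducible are coprime to
  \<open>P0\<close>, so they divide \<open>f\<close> exactly when they divide
  \<open>g\<close>.\<close>

lemma prime_power_divisors_mult_irred:
  assumes P0: "P0 \<in> irreds p" and f: "pcong (int p) f (P0 * g)"
  shows "prime_power_divisors f = insert (P0, 1) ((\<lambda>(P, k). if P = P0 then (P0, Suc k) else (P, k)) ` prime_power_divisors g)"
    (is "_ = insert _ (?s ` _)")
proof -
  have eq: "mdvd p Q f \<longleftrightarrow> mdvd p Q (P0 * g)" for Q
    using mdvd_cong f pcong_sym by blast
  have same: "mdvd p (P0 ^ Suc k) f \<longleftrightarrow> mdvd p (P0 ^ k) g" for k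
  proof -
    have "pcong (int p) (P0 * g) (P0 ^ Suc k * h) \<longleftrightarrow> pcong (int p) g (P0 ^ k * h)" for h
    proof -
      have "P0 ^ Suc k * h = P0 * (P0 ^ k * h)" by (simp add: mult.assoc)
      then show ?thesis
        using pcong_mult_cancel[OF _ irreds_monic[OF P0], of g "P0 ^ k * h"]
          pcong_mult_left[of "int p" g "P0 ^ k * h" P0] by metis
    qed
    then show ?thesis unfolding eq unfolding mdvd_def by simp
  qed
  have other: "mdvd p (P ^ k) f \<longleftrightarrow> mdvd p (P ^ k) g" if "P \<in> irreds p" "P \<noteq> P0" for P k
  proof
    have "\<not> mdvd p P P0" using irreds_mdvd_eq that P0 by blast
    then have "mcoprime p (P ^ k) P0"
      using mirred_coprime mcoprime_power that(1) unfolding irreds_def by blast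
    moreover assume "mdvd p (P ^ k) f"
    ultimately show "mdvd p (P ^ k) g" using eq mdvd_coprime by blast
  qed (simp add: eq mdvd_mult)
  show ?thesis
  proof (intro set_eqI iffI)
    fix x assume "x \<in> prime_power_divisors f"
    then obtain P k where x: "x = (P, k)" "P \<in> irreds p" "k \<ge> 1" "mdvd p (P ^ k) f"
      by (auto simp: prime_power_divisors_def)
    show "x \<in> insert (P0, 1) (?s ` prime_power_divisors g)"
    proof (cases "P = P0")
      case True
      obtain j where j: "k = Suc j" using x(3) by (cases k) auto
      show ?thesis
      proof (cases "j = 0")
        case False
        then have "(P0, j) \<in> prime_power_divisors g" using same[of j] x j True by (simp add: prime_power_divisors_def)
        then show ?thesis using x(1) j True by (force intro!: image_eqI[of _ _ "(P0, j)"])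
      qed (use x True j in auto)
    next
      case False
      then have "(P, k) \<in> prime_power_divisors g" using other x by (simp add: prime_power_divisors_def)
      then show ?thesis using x(1) False by (force intro!: image_eqI[of _ _ "(P, k)"])
    qed
  next
    fix x assume "x \<in> insert (P0, 1) (?s ` prime_power_divisors g)"
    moreover have "(P0, 1) \<in> prime_power_divisors f"
      using mdvdI[OF f] P0 by (simp add: prime_power_divisors_def)
    ultimately show "x \<in> prime_power_divisors f"
      using same other P0 by (auto simp: prime_power_divisors_def split: if_splits simp del: power_Suc)
  qed
qed

text \<open>Splitting off an irreducible divisor \<open>P0\<close> removes exactly one pair, whose
  weight \<open>degree P0\<close> is the drop in degree; shifting exponents leaves the other weights
  unchanged.\<close>

lemma sum_degree_prime_power_divisors:
  assumes "lead_coeff f = 1"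
  shows "finite (prime_power_divisors f) \<and> (\<Sum>(P, k)\<in>prime_power_divisors f. degree P) = degree f"
  using assms
proof (induction "degree f" arbitrary: f rule: less_induct)
  case less
  show ?case
  proof (cases "degree f = 0")
    case True
    have "prime_power_divisors f = {}"
    proof (rule ccontr)
      assume "prime_power_divisors f \<noteq> {}"
      then obtain P k where Pk: "(P, k) \<in> prime_power_divisors f" by auto
      then have "P \<in> irreds p" "k \<ge> 1" by (auto simp: prime_power_divisors_def)
      then show False using prime_power_divisors_degree[OF Pk less.prems] True irreds_degree[of P] by auto
    qed
    then show ?thesis using True by simp
  next
    case False
    then obtain P0 where P0: "P0 \<in> irreds p" "mdvd p P0 f"
      using exists_irred_divisor[OF less.prems] by auto
    obtain g where g: "pcong (int p) f (P0 * g)" "lead_coeff g = 1" "degree f = degree P0 + degree g"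
      using mdvd_monicE[OF P0(2) irreds_monic[OF P0(1)] less.prems] by blast
    have IH: "finite (prime_power_divisors g)" "(\<Sum>(P, k)\<in>prime_power_divisors g. degree P) = degree g"
      using less.hyps[of g] g irreds_degree[OF P0(1)] by auto
    define s where "s = (\<lambda>(P, k). if P = P0 then (P0, Suc k) else (P, k::nat))"
    have s: "prime_power_divisors f = insert (P0, 1) (s ` prime_power_divisors g)"
      unfolding s_def by (rule prime_power_divisors_mult_irred[OF P0(1) g(1)])
    have inj: "inj_on s (prime_power_divisors g)" by (auto simp: inj_on_def s_def split: if_splits)
    \<comment> \<open>Exponents in \<open>prime_power_divisors g\<close> start at 1, so those
      shifted at \<open>P0\<close> are at least 2.\<close>
    have "(P0, 1) \<notin> s ` prime_power_divisors g" by (auto simp: s_def prime_power_divisors_def split: if_splits)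
    then have "(\<Sum>(P, k)\<in>prime_power_divisors f. degree P) = degree P0 + (\<Sum>(P, k)\<in>s ` prime_power_divisors g. degree P)"
      unfolding s using IH(1) by (subst sum.insert) auto
    also have "(\<Sum>(P, k)\<in>s ` prime_power_divisors g. degree P) = (\<Sum>(P, k)\<in>prime_power_divisors g. degree P)"
      by (subst sum.reindex[OF inj], rule sum.cong) (auto simp: s_def)
    finally show ?thesis using IH g(3) s by simp
  qed
qed

end


section \<open>Counting irreducible polynomials modulo a prime\<close>

text \<open>Applied to the values \<open>c i k\<close> of a p-adic coefficient tuple, this is an
  integer representative of the p-adic polynomial modulo p^k.\<close>

definition tuple_poly :: "nat \<Rightarrow> (nat \<Rightarrow> int) \<Rightarrow> int poly" where
  "tuple_poly n v = monom 1 n + (\<Sum>i<n. monom (v i) i)"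

lemma coeff_tuple_poly:
  "coeff (tuple_poly n v) j = (if j < n then v j else if j = n then 1 else 0)"
proof -
  have "(\<Sum>i<n. coeff (monom (v i) i) j) = (if j < n then v j else 0)"
    by (simp add: if_distrib cong: if_cong)
  then show ?thesis by (simp add: tuple_poly_def coeff_sum)
qed

lemma degree_tuple_poly [simp]: "degree (tuple_poly n v) = n"
  by (rule antisym, rule degree_le) (auto simp: coeff_tuple_poly intro: le_degree)

lemma lead_coeff_tuple_poly: "lead_coeff (tuple_poly n v) = 1"
  by (simp add: coeff_tuple_poly)

context prime_modulus
begin

lemma bij_betw_tuple_poly:
  "bij_betw (tuple_poly n) ({..<n} \<rightarrow>\<^sub>E {0..<int p}) (monics p n)"
proof (rule bij_betw_byWitness[where f' = "\<lambda>f. restrict (coeff f) {..<n}"])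
  show "\<forall>v\<in>{..<n} \<rightarrow>\<^sub>E {0..<int p}. restrict (coeff (tuple_poly n v)) {..<n} = v"
    by (auto simp: coeff_tuple_poly fun_eq_iff PiE_def extensional_def)
  show "\<forall>f\<in>monics p n. tuple_poly n (restrict (coeff f) {..<n}) = f"
    by (auto simp: monics_def poly_eq_iff coeff_tuple_poly coeff_eq_0)
  show "tuple_poly n ` ({..<n} \<rightarrow>\<^sub>E {0..<int p}) \<subseteq> monics p n"
    using p_gt_1 by (auto simp: monics_def coeff_tuple_poly PiE_def Pi_def)
  show "(\<lambda>f. restrict (coeff f) {..<n}) ` monics p n \<subseteq> {..<n} \<rightarrow>\<^sub>E {0..<int p}"
    by (auto simp: monics_def split: if_splits)
qed

lemma card_monics: "card (monics p n) = p ^ n"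
  using bij_betw_same_card[OF bij_betw_tuple_poly[of n]] by (simp add: card_PiE)

lemma finite_monics: "finite (monics p n)"
  using bij_betw_finite[OF bij_betw_tuple_poly[of n]] by (simp add: finite_PiE)

text \<open>Multiplication by \<open>Q\<close> followed by reduction is a bijection from the monics
  of degree \<open>n - degree Q\<close>: injective by cancellation, surjective because a monic
  cofactor exists.\<close>

lemma card_monic_multiples:
  assumes "lead_coeff Q = 1" "degree Q \<le> n"
  shows "card {f \<in> monics p n. mdvd p Q f} = p ^ (n - degree Q)"
proof -
  let ?s = "\<lambda>h. reduce_poly (int p) (Q * h)"
  have s: "?s h \<in> monics p n" if "h \<in> monics p (n - degree Q)" for h
  proof -
    have h: "lead_coeff h = 1" "degree h = n - degree Q" using that by (auto simp: monics_def)
    then have "h \<noteq> 0" by auto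
    then have "degree (Q * h) = n" using degree_monic_mult[OF assms(1)] h(2) assms(2) by simp
    then show ?thesis using reduce_poly_monic[OF lead_coeff_monic_mult[OF assms(1) h(1)]] by simp
  qed
  have "inj_on ?s (monics p (n - degree Q))"
  proof (rule inj_onI)
    fix g h assume gh: "g \<in> monics p (n - degree Q)" "h \<in> monics p (n - degree Q)" "?s g = ?s h"
    have "pcong (int p) (Q * g) (Q * h)"
      using pcong_reduce_poly[of "int p" "Q * g"] pcong_sym[OF pcong_reduce_poly[of "int p" "Q * h"]] gh(3)
      by (metis pcong_trans)
    then show "g = h" using pcong_mult_cancel[OF _ assms(1)] monics_eqI gh(1,2) by blast
  qed
  moreover have "?s ` monics p (n - degree Q) = {f \<in> monics p n. mdvd p Q f}"
  proof (intro set_eqI iffI)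
    fix f assume "f \<in> ?s ` monics p (n - degree Q)"
    then show "f \<in> {f \<in> monics p n. mdvd p Q f}"
      using s by (auto intro!: mdvdI pcong_sym[OF pcong_reduce_poly])
  next
    fix f assume "f \<in> {f \<in> monics p n. mdvd p Q f}"
    then have f: "f \<in> monics p n" "mdvd p Q f" "lead_coeff f = 1" "degree f = n"
      by (auto simp: monics_def)
    obtain h where h: "pcong (int p) f (Q * h)" "lead_coeff h = 1" "degree f = degree Q + degree h"
      using mdvd_monicE[OF f(2) assms(1) f(3)] .
    have hm: "reduce_poly (int p) h \<in> monics p (n - degree Q)"
      using reduce_poly_monic[OF h(2)] h(3) f(4) by simp
    have "pcong (int p) f (Q * reduce_poly (int p) h)"
      by (rule pcong_trans[OF h(1)]) (intro pcong_mult_left pcong_reduce_poly)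
    then have "pcong (int p) f (?s (reduce_poly (int p) h))" using pcong_reduce_poly by (rule pcong_trans)
    then have "f = ?s (reduce_poly (int p) h)" using monics_eqI f(1) s[OF hm] by blast
    then show "f \<in> ?s ` monics p (n - degree Q)" using hm by blast
  qed
  ultimately show ?thesis using card_image card_monics by metis
qed

section \<open>Counting prime powers and irreducibles of a given degree\<close>

definition prime_powers_deg :: "nat \<Rightarrow> (int poly \<times> nat) set" where
  "prime_powers_deg n = {(P, k). P \<in> irreds p \<and> k \<ge> 1 \<and> k * degree P = n}"

lemma finite_prime_powers_deg: "finite (prime_powers_deg n)"
proof (rule finite_subset)
  show "prime_powers_deg n \<subseteq> (\<Union>d\<le>n. monics p d) \<times> {..n}"
    using irreds_in_monics irreds_degree by (force simp: prime_powers_deg_def)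
  show "finite ((\<Union>d\<le>n. monics p d) \<times> {..n})" using finite_monics by auto
qed

text \<open>Double counting of the pairs (polynomial of degree \<open>n\<close>, prime power dividing it), weighted by the
  degree of the prime: the polynomial analogue of summing the von Mangoldt function.\<close>

lemma sum_prime_powers_deg_convolution:
  "(\<Sum>j=1..n. (\<Sum>(P, k)\<in>prime_powers_deg j. degree P) * p ^ (n - j)) = n * p ^ n"
proof -
  define T where "T = (\<Union>j\<in>{1..n}. prime_powers_deg j)"
  have finT: "finite T" unfolding T_def using finite_prime_powers_deg by auto
  have memT: "(P, k) \<in> T \<longleftrightarrow> P \<in> irreds p \<and> k \<ge> 1 \<and> k * degree P \<le> n" for P k
    using irreds_degree[of P] by (force simp: T_def prime_powers_deg_def)
  have pp: "prime_power_divisors f = {x \<in> T. mdvd p (fst x ^ snd x) f}" if "f \<in> monics p n" for f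
    using prime_power_divisors_degree[of _ _ f] that memT by (auto simp: prime_power_divisors_def monics_def)
  have "n * p ^ n = (\<Sum>f\<in>monics p n. degree f)"
    by (simp add: card_monics monics_def[of p n])
      (metis (mono_tags, lifting) card_monics monics_def mult.commute)
  also have "\<dots> = (\<Sum>f\<in>monics p n. \<Sum>x | x \<in> T \<and> mdvd p (fst x ^ snd x) f. degree (fst x))"
  proof (rule sum.cong)
    fix f assume f: "f \<in> monics p n"
    then show "degree f = (\<Sum>x | x \<in> T \<and> mdvd p (fst x ^ snd x) f. degree (fst x))"
      using sum_degree_prime_power_divisors[of f] pp[OF f] by (auto simp: monics_def case_prod_unfold)
  qed simp
  also have "\<dots> = (\<Sum>x\<in>T. \<Sum>f | f \<in> monics p n \<and> mdvd p (fst x ^ snd x) f. degree (fst x))"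
    by (rule sum.swap_restrict) (use finT finite_monics in auto)
  also have "\<dots> = (\<Sum>x\<in>T. degree (fst x) * p ^ (n - snd x * degree (fst x)))"
  proof (rule sum.cong)
    fix x assume "x \<in> T"
    then obtain P k where x: "x = (P, k)" "P \<in> irreds p" "k * degree P \<le> n"
      using memT by (cases x) auto
    then have "card {f \<in> monics p n. mdvd p (P ^ k) f} = p ^ (n - k * degree P)"
      using card_monic_multiples[OF lead_coeff_monic_power[OF irreds_monic[OF x(2)]], of k n]
        degree_irred_power[OF x(2), of k] by simp
    then show "(\<Sum>f | f \<in> monics p n \<and> mdvd p (fst x ^ snd x) f. degree (fst x)) =
        degree (fst x) * p ^ (n - snd x * degree (fst x))"
      using x(1) by simp
  qed simp
  also have "\<dots> = (\<Sum>j=1..n. \<Sum>x\<in>prime_powers_deg j. degree (fst x) * p ^ (n - snd x * degree (fst x)))"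
    unfolding T_def by (rule sum.UNION_disjoint) (use finite_prime_powers_deg in \<open>auto simp: prime_powers_deg_def\<close>)
  also have "\<dots> = (\<Sum>j=1..n. (\<Sum>(P, k)\<in>prime_powers_deg j. degree P) * p ^ (n - j))"
    by (rule sum.cong) (auto simp: sum_distrib_right prime_powers_deg_def case_prod_unfold intro!: sum.cong)
  finally show ?thesis by simp
qed

text \<open>Subtracting \<open>p\<close> times the convolution identity for \<open>n - 1\<close>
  from the one for \<open>n\<close> leaves only the term \<open>j = n\<close>, with value n p^n - (n
  - 1) p^n.\<close>

lemma sum_degree_prime_powers_deg:
  assumes "n \<ge> 1"
  shows "(\<Sum>(P, k)\<in>prime_powers_deg n. degree P) = p ^ n"
proof -
  obtain m where m: "n = Suc m" using assms by (cases n) auto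
  let ?A = "\<lambda>j. \<Sum>(P, k)\<in>prime_powers_deg j. degree P"
  have "(\<Sum>j=1..m. ?A j * p ^ (Suc m - j)) = p * (\<Sum>j=1..m. ?A j * p ^ (m - j))"
    unfolding sum_distrib_left by (rule sum.cong) (auto simp: Suc_diff_le)
  then have "Suc m * p ^ Suc m = p * (m * p ^ m) + ?A (Suc m)"
    using sum_prime_powers_deg_convolution[of "Suc m"] sum_prime_powers_deg_convolution[of m] by simp
  then show ?thesis by (simp add: m)
qed

text \<open>For \<open>k \<ge> 2\<close> the base has degree at most n/2, and it determines
  \<open>k\<close>. So it suffices to count monic polynomials of degree 1 to
  \<open>n div 2\<close>.\<close>

lemma card_proper_prime_powers_deg:
  "card {(P, k) \<in> prime_powers_deg n. k \<ge> 2} \<le> n * p ^ (n div 2)"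
proof -
  let ?S = "{(P, k) \<in> prime_powers_deg n. k \<ge> 2}"
  have "inj_on fst ?S"
    using irreds_degree by (fastforce simp: inj_on_def prime_powers_deg_def)
  then have "card ?S = card (fst ` ?S)" by (simp add: card_image)
  also have "\<dots> \<le> card (\<Union>d\<in>{1..n div 2}. monics p d)"
  proof (rule card_mono)
    show "fst ` ?S \<subseteq> (\<Union>d\<in>{1..n div 2}. monics p d)"
    proof clarsimp
      fix P k assume "(P, k) \<in> prime_powers_deg n" "2 \<le> k"
      then have P: "P \<in> irreds p" "k * degree P = n" by (auto simp: prime_powers_deg_def)
      have "2 * degree P \<le> n" using mult_le_mono1[OF \<open>2 \<le> k\<close>, of "degree P"] P(2) by simp
      then show "\<exists>d\<in>{Suc 0..n div 2}. P \<in> monics p d"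
        using irreds_in_monics[OF P(1)] irreds_degree[OF P(1)] by (intro bexI[of _ "degree P"]) auto
    qed
  qed (use finite_monics in auto)
  also have "\<dots> \<le> (\<Sum>d=1..n div 2. card (monics p d))" by (rule card_UN_le) simp
  also have "\<dots> \<le> (\<Sum>d=1..n div 2. p ^ (n div 2))"
    unfolding card_monics
    by (rule sum_mono, rule power_increasing) (use prime_gt_0_nat[OF prime_p] in auto)
  also have "\<dots> \<le> n * p ^ (n div 2)" by simp
  finally show ?thesis .
qed

lemma prime_powers_deg_split:
  "prime_powers_deg n = (\<lambda>P. (P, 1)) ` {P \<in> irreds p. degree P = n} \<union> {(P, k) \<in> prime_powers_deg n. k \<ge> 2}"
  by (auto simp: prime_powers_deg_def)

lemma finite_irreds_degree: "finite {P \<in> irreds p. degree P = n}"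
  by (rule finite_subset[OF _ finite_monics[of n]]) (auto dest: irreds_in_monics)

text \<open>In the sum of degrees equal to \<open>p ^ n\<close>, each irreducible of degree
  \<open>n\<close> contributes \<open>n\<close>, and each of the few proper powers contributes at
  most \<open>n\<close>.\<close>

lemma card_irreds_bounds:
  assumes "n \<ge> 1"
  shows "n * card {P \<in> irreds p. degree P = n} \<le> p ^ n"
    and "p ^ n \<le> n * card {P \<in> irreds p. degree P = n} + n * (n * p ^ (n div 2))"
proof -
  let ?A = "{P \<in> irreds p. degree P = n}" and ?S = "{(P, k) \<in> prime_powers_deg n. k \<ge> 2}"
  have finS: "finite ?S" by (rule finite_subset[OF _ finite_prime_powers_deg[of n]]) auto
  have "p ^ n = (\<Sum>(P, k)\<in>prime_powers_deg n. degree P)" by (simp add: sum_degree_prime_powers_deg[OF assms])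
  also have "\<dots> = (\<Sum>(P, k)\<in>(\<lambda>P. (P, 1::nat)) ` ?A. degree P) + (\<Sum>(P, k)\<in>?S. degree P)"
    by (subst prime_powers_deg_split[of n], rule sum.union_disjoint)
      (use finS finite_irreds_degree in auto)
  also have "(\<Sum>(P, k)\<in>(\<lambda>P. (P, 1::nat)) ` ?A. degree P) = n * card ?A"
    by (subst sum.reindex) (auto simp: inj_on_def)
  finally have eq: "p ^ n = n * card ?A + (\<Sum>(P, k)\<in>?S. degree P)" .
  have "(\<Sum>(P, k)\<in>?S. degree P) \<le> (\<Sum>x\<in>?S. n)"
    by (rule sum_mono) (auto simp: prime_powers_deg_def)
  also have "\<dots> \<le> n * (n * p ^ (n div 2))"
    using card_proper_prime_powers_deg[of n] by simp
  finally show "p ^ n \<le> n * card ?A + n * (n * p ^ (n div 2))" using eq by simp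
  show "n * card ?A \<le> p ^ n" using eq by simp
qed

text \<open>Each pair \<open>(P, k)\<close> determines only one canonical residue, so there are no
  more such residues than pairs.\<close>

lemma card_prime_powers:
  "card {f \<in> monics p n. \<exists>(P, k)\<in>prime_powers_deg n. pcong (int p) f (P ^ k)}
    \<le> card {P \<in> irreds p. degree P = n} + n * p ^ (n div 2)"
proof -
  have "{f \<in> monics p n. \<exists>(P, k)\<in>prime_powers_deg n. pcong (int p) f (P ^ k)}
      \<subseteq> (\<lambda>(P, k). reduce_poly (int p) (P ^ k)) ` prime_powers_deg n"
  proof clarify
    fix f P k assume f: "f \<in> monics p n" "(P, k) \<in> prime_powers_deg n" "pcong (int p) f (P ^ k)"
    then have "lead_coeff (P ^ k) = 1"
      by (intro lead_coeff_monic_power irreds_monic) (auto simp: prime_powers_deg_def)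
    then have "f = reduce_poly (int p) (P ^ k)"
      using monics_eqI[OF pcong_trans[OF f(3) pcong_reduce_poly] f(1) reduce_poly_monic] by blast
    then show "f \<in> (\<lambda>(P, k). reduce_poly (int p) (P ^ k)) ` prime_powers_deg n" using f(2) by force
  qed
  then have "card {f \<in> monics p n. \<exists>(P, k)\<in>prime_powers_deg n. pcong (int p) f (P ^ k)} \<le> card (prime_powers_deg n)"
    by (meson finite_prime_powers_deg surj_card_le)
  also have "\<dots> \<le> card ((\<lambda>P. (P, 1::nat)) ` {P \<in> irreds p. degree P = n})
      + card {(P, k) \<in> prime_powers_deg n. k \<ge> 2}"
    by (subst prime_powers_deg_split[of n]) (rule card_Un_le)
  also have "\<dots> \<le> card {P \<in> irreds p. degree P = n} + n * p ^ (n div 2)"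
    by (intro add_mono card_proper_prime_powers_deg card_image_le finite_irreds_degree)
  finally show ?thesis .
qed

end

section \<open>Hensel lifting\<close>

context prime_modulus
begin

text \<open>Take an irreducible divisor \<open>P\<close> and the largest power \<open>P ^ k\<close>
  dividing \<open>f\<close>. The cofactor is not divisible by \<open>P\<close>, hence coprime to
  \<open>P ^ k\<close>; the first case is the one where it is 1.\<close>

lemma prime_power_or_coprime_factors:
  assumes "lead_coeff f = 1" "degree f = n" "n \<ge> 1"
  obtains (prime_power) P k where "(P, k) \<in> prime_powers_deg n" "pcong (int p) f (P ^ k)"
  | (factors) g h where "lead_coeff g = 1" "lead_coeff h = 1" "degree g \<ge> 1" "degree h \<ge> 1"
      "mcoprime p g h" "pcong (int p) f (g * h)"
proof -
  obtain P where P: "P \<in> irreds p" "mdvd p P f" using exists_irred_divisor assms by blast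
  have bounded: "k \<le> degree f" if "mdvd p (P ^ k) f" for k
  proof (cases "k = 0")
    case False
    then have "(P, k) \<in> prime_power_divisors f" using P(1) that by (simp add: prime_power_divisors_def)
    then have "k * degree P \<le> degree f" by (rule prime_power_divisors_degree[OF _ assms(1)])
    moreover have "k * 1 \<le> k * degree P" using irreds_degree[OF P(1)] by (intro mult_le_mono2)
    ultimately show ?thesis by linarith
  qed simp
  have "mdvd p (P ^ 1) f" using P(2) by simp
  then obtain k where k: "mdvd p (P ^ k) f" "\<And>j. mdvd p (P ^ j) f \<Longrightarrow> j \<le> k"
    using Nat.ex_has_greatest_nat[of "\<lambda>k. mdvd p (P ^ k) f" 1 "degree f"] bounded by blast
  have "k \<ge> 1" using k(2)[of 1] P(2) by simp
  have Pk: "lead_coeff (P ^ k) = 1" "degree (P ^ k) = k * degree P"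
    using P(1) lead_coeff_monic_power[OF irreds_monic] degree_irred_power by auto
  obtain h where h: "pcong (int p) f (P ^ k * h)" "lead_coeff h = 1" "degree f = degree (P ^ k) + degree h"
    using mdvd_monicE[OF k(1) Pk(1) assms(1)] .
  show ?thesis
  proof (cases "degree h = 0")
    case True
    then have "h = 1" using h(2) monic_degree_0 by blast
    then show ?thesis
      using prime_power[of P k] h Pk P(1) assms(2) \<open>k \<ge> 1\<close> by (simp add: prime_powers_deg_def)
  next
    case False
    have "\<not> mdvd p P h"
    proof
      assume "mdvd p P h"
      then obtain h' where "pcong (int p) h (P * h')" unfolding mdvd_def by blast
      from pcong_trans[OF h(1) pcong_mult_left[OF this]]
      have "mdvd p (P ^ Suc k) f" by (intro mdvdI[of _ _ _ h']) (simp add: algebra_simps)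
      then show False using k(2) by fastforce
    qed
    then have "mcoprime p (P ^ k) h"
      using mirred_coprime mcoprime_power P(1) unfolding irreds_def by blast
    moreover have "degree (P ^ k) \<ge> 1"
      using Pk(2) \<open>k \<ge> 1\<close> irreds_degree[OF P(1)] by (simp add: Suc_le_eq)
    ultimately show ?thesis using factors[OF Pk(1) h(2) _ _ _ h(1)] False by simp
  qed
qed

text \<open>Here \<open>u\<close> is reduced modulo \<open>g\<close> by division; the degree bound on \<open>w\<close> is then forced by comparing
  leading terms in \<open>e \<equiv> u h + g w\<close>, because \<open>g\<close> is monic and \<open>deg e < deg g + deg h\<close>.\<close>

lemma hensel_step:
  assumes k: "k \<ge> 1" and F: "lead_coeff F = 1"
    and g: "lead_coeff g = 1" and h: "lead_coeff h = 1"
    and cop: "mcoprime p g h" and cong: "pcong (int p ^ k) F (g * h)"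
  obtains u w where "u = 0 \<or> degree u < degree g" "w = 0 \<or> degree w < degree h"
    "pcong (int p ^ Suc k) F ((g + smult (int p ^ k) u) * (h + smult (int p ^ k) w))"
proof -
  obtain e where e: "F - g * h = smult (int p ^ k) e"
    using cong unfolding pcong_def by (auto elim!: dvdE)
  have nz: "g \<noteq> 0" "h \<noteq> 0" using g h by auto
  have "int p dvd int p ^ k" using k by (simp add: dvd_power)
  then have "pcong (int p) F (g * h)" using cong by (rule pcong_mod_dvd[rotated])
  then have degF: "degree F = degree g + degree h"
    using pcong_monic_degree[OF _ F lead_coeff_monic_mult[OF g h]] degree_monic_mult[OF g nz(2)]
    by simp
  have coeff_e: "coeff e i = 0" if "i \<ge> degree g + degree h" for i
  proof -
    have "coeff (F - g * h) i = 0"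
    proof (cases "i = degree g + degree h")
      case True
      then show ?thesis using F degF g h by (simp add: coeff_mult_degree_sum)
    next
      case False
      then show ?thesis using that degF degree_monic_mult[OF g nz(2)] by (simp add: coeff_eq_0)
    qed
    then show ?thesis using e p_gt_1 by simp
  qed
  obtain s t where st: "pcong (int p) (s * g + t * h) 1" using cop unfolding mcoprime_def by blast
  obtain q u where qu: "t * e = g * q + u" "u = 0 \<or> degree u < degree g"
    using monic_divmod[OF g] .
  \<comment> \<open>Reduction makes the leading coefficient of a nonzero \<open>w\<close> nonzero
    modulo \<open>p\<close>, so that comparing coefficients modulo \<open>p\<close> bounds its
    degree.\<close>
  define w where "w = reduce_poly (int p) (s * e + q * h)"
  have "pcong (int p) (e * (s * g + t * h)) (e * 1)" by (rule pcong_mult_left[OF st])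
  also have "e * (s * g + t * h) = u * h + g * (s * e + q * h)"
  proof -
    have "e * (s * g + t * h) = (t * e) * h + g * (s * e)" by (simp add: algebra_simps)
    then show ?thesis unfolding qu(1) by (simp add: algebra_simps)
  qed
  finally have "pcong (int p) (u * h + g * (s * e + q * h)) e" by simp
  moreover have "pcong (int p) (u * h + g * (s * e + q * h)) (u * h + g * w)"
    unfolding w_def by (intro pcong_add pcong_refl pcong_mult_left pcong_reduce_poly)
  ultimately have uw: "pcong (int p) e (u * h + g * w)" by (meson pcong_sym pcong_trans)
  have degw: "w = 0 \<or> degree w < degree h"
  proof (rule ccontr)
    assume "\<not> ?thesis"
    then have w: "w \<noteq> 0" "degree w \<ge> degree h" by auto
    let ?i = "degree g + degree w"
    have "coeff (u * h) ?i = 0"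
    proof (cases "u = 0")
      case False
      then have "degree u < degree g" using qu(2) by simp
      then have "degree (u * h) < ?i" using degree_mult_le[of u h] w(2) by linarith
      then show ?thesis by (rule coeff_eq_0)
    qed simp
    moreover have "coeff e ?i = 0" using coeff_e w(2) by simp
    moreover have "coeff (g * w) ?i = lead_coeff w" using g by (simp add: coeff_mult_degree_sum)
    ultimately have "0 mod int p = lead_coeff w mod int p"
      using uw unfolding pcong_iff_coeff by (metis coeff_add add_0)
    then show False
      using reduce_poly_not_dvd_lead[of "int p" "s * e + q * h"] w(1) unfolding w_def
      by (metis mod_0 mod_0_imp_dvd)
  qed
  let ?c = "int p ^ k"
  obtain d where d: "e - (u * h + g * w) = [:int p:] * d" using uw unfolding pcong_def by (auto elim!: dvdE)
  have "F - (g + smult ?c u) * (h + smult ?c w)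
      = smult ?c (e - (u * h + g * w)) - smult (?c * ?c) (u * w)"
    using e by (simp add: algebra_simps smult_add_right smult_diff_right)
  \<comment> \<open>As \<open>k \<ge> 1\<close>, 2k = (k + 1) + (k - 1), so the quadratic term is
    also a multiple of p^(k+1).\<close>
  also have "\<dots> = [:int p ^ Suc k:] * (d - smult (int p ^ (k - 1)) (u * w))"
  proof -
    obtain m where "k = Suc m" using k by (cases k) auto
    then show ?thesis unfolding d by (simp add: algebra_simps smult_diff_right)
  qed
  finally have "pcong (int p ^ Suc k) F ((g + smult ?c u) * (h + smult ?c w))"
    unfolding pcong_def by (metis dvd_triv_left)
  then show ?thesis using that qu(2) degw by blast
qed

text \<open>Each correction is a multiple of \<open>p\<close>, so the Bezout relation modulo
  \<open>p\<close> survives to the next step. The induction starts at modulus p, hence the exponent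
  \<open>Suc k\<close>.\<close>

lemma hensel_lift:
  assumes F: "lead_coeff F = 1" and g: "lead_coeff g = 1" and h: "lead_coeff h = 1"
    and cop: "mcoprime p g h" and cong: "pcong (int p) F (g * h)"
  shows "\<exists>g' h'. lead_coeff g' = 1 \<and> lead_coeff h' = 1 \<and> degree g' = degree g \<and> degree h' = degree h
    \<and> mcoprime p g' h' \<and> pcong (int p ^ Suc k) F (g' * h')"
proof (induction k)
  case 0
  then show ?case using assms by auto
next
  case (Suc k)
  then obtain g' h' where gh: "lead_coeff g' = 1" "lead_coeff h' = 1" "degree g' = degree g"
    "degree h' = degree h" "mcoprime p g' h'" "pcong (int p ^ Suc k) F (g' * h')" by blast
  let ?c = "int p ^ Suc k"
  obtain u w where uw: "u = 0 \<or> degree u < degree g'" "w = 0 \<or> degree w < degree h'"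
    "pcong (int p ^ Suc (Suc k)) F ((g' + smult ?c u) * (h' + smult ?c w))"
    using hensel_step[OF _ F gh(1,2,5,6)] by auto
  have eq: "pcong (int p) f (f + smult ?c v)" for f v
    by (simp add: pcong_iff_coeff mult.assoc)
  have "mcoprime p (g' + smult ?c u) (h' + smult ?c w)"
    using mcoprime_cong[OF gh(5) eq eq] .
  then show ?case
    using monic_add_lower[OF gh(1) uw(1), of ?c] monic_add_lower[OF gh(2) uw(2), of ?c] gh(3,4) uw(3)
    by metis
qed

end

section \<open>Reducibility over the p-adic integers\<close>

text \<open>Koenig's lemma: among the finitely many values at the next level, the pigeonhole
  principle picks one that infinitely many of the surviving indices share.\<close>

lemma compactness_sequence:
  fixes q :: "nat \<Rightarrow> nat \<Rightarrow> 'a"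
  assumes fin: "\<And>k. finite (range (q k))" and red: "\<And>k m. q k m = r k (q (Suc k) m)"
  obtains y where "\<And>k. infinite {m. q k m = y k}" "\<And>k. r k (y (Suc k)) = y k"
proof -
  have "\<exists>y. \<forall>k. infinite {m. q k m = y k} \<and> r k (y (Suc k)) = y k"
  proof (rule dependent_nat_choice)
    show "\<exists>y. infinite {m. q 0 m = y}"
      using pigeonhole_infinite[of UNIV "q 0"] fin by auto
  next
    fix y k assume "infinite {m. q k m = y}"
    moreover have "finite (q (Suc k) ` {m. q k m = y})"
      by (rule finite_subset[OF _ fin[of "Suc k"]]) auto
    ultimately obtain m0 where m0: "q k m0 = y"
      "infinite {m \<in> {m. q k m = y}. q (Suc k) m = q (Suc k) m0}"
      using pigeonhole_infinite by blast
    have "infinite {m. q (Suc k) m = q (Suc k) m0}"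
      by (rule infinite_super[OF _ m0(2)]) auto
    then show "\<exists>y'. infinite {m. q (Suc k) m = y'} \<and> r k y' = y"
      using m0(1) red by metis
  qed
  then show ?thesis using that by blast
qed

lemma Zp_mod:
  assumes "x \<in> Zp p" "k \<le> m"
  shows "x m mod int p ^ k = x k"
  using assms(2)
proof (induction m rule: dec_induct)
  case base
  then show ?case using assms(1) by (auto simp: Zp_def)
next
  case (step m)
  have "x (Suc m) mod int p ^ m = x m" using assms(1) by (auto simp: Zp_def)
  then have "x (Suc m) mod int p ^ k = x m mod int p ^ k"
    by (metis le_imp_power_dvd mod_mod_cancel step.hyps(1))
  then show ?case using step by simp
qed

lemma pcong_tuple_poly_level:
  assumes "\<And>i. i < n \<Longrightarrow> c i \<in> Zp p" "k \<le> m"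
  shows "pcong (int p ^ k) (tuple_poly n (\<lambda>i. c i m)) (tuple_poly n (\<lambda>i. c i k))"
  using Zp_mod[OF assms(1) assms(2)] Zp_mod[OF assms(1) order.refl]
  by (auto simp: pcong_iff_coeff coeff_tuple_poly)

text \<open>Stated for sequences with degree bounds instead of exact degrees, since a nonzero p-adic
  coefficient may vanish at a given level.\<close>

lemma coeff_mult_at_bounds:
  fixes g h :: "nat \<Rightarrow> int"
  assumes "\<And>i. i > a \<Longrightarrow> g i = 0" "\<And>i. i > b \<Longrightarrow> h i = 0"
  shows "(\<Sum>i\<le>a + b. g i * h (a + b - i)) = g a * h b"
proof -
  have "(\<Sum>i\<le>a + b. g i * h (a + b - i)) = (\<Sum>i\<in>{a}. g i * h (a + b - i))"
  proof (rule sum.mono_neutral_right)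
    show "\<forall>i\<in>{..a + b} - {a}. g i * h (a + b - i) = 0"
    proof
      fix i assume "i \<in> {..a + b} - {a}"
      then have "i > a \<or> a + b - i > b" by auto
      then show "g i * h (a + b - i) = 0" using assms by auto
    qed
  qed auto
  then show ?thesis by simp
qed

lemma coeff_mult_beyond_bounds:
  fixes g h :: "nat \<Rightarrow> int"
  assumes "\<And>i. i > a \<Longrightarrow> g i = 0" "\<And>i. i > b \<Longrightarrow> h i = 0" "j > a + b"
  shows "(\<Sum>i\<le>j. g i * h (j - i)) = 0"
proof (rule sum.neutral, rule ballI)
  fix i assume "i \<in> {..j}"
  then have "i > a \<or> j - i > b" using assms(3) by auto
  then show "g i * h (j - i) = 0" using assms(1,2) by auto
qed

text \<open>The reduction on the right matches \<open>zp_one\<close>, which is 1 mod p^k and thus 0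
  at level 0.\<close>

lemma monic_poly_eq_tuple_poly:
  assumes "\<And>i. i < n \<Longrightarrow> c i \<in> Zp p"
  shows "monic_poly p n c j k = coeff (tuple_poly n (\<lambda>i. c i k)) j mod int p ^ k"
  using Zp_mod[OF assms order.refl]
  by (auto simp: monic_poly_def coeff_tuple_poly zp_one_def zp_zero_def)

text \<open>Degree bounds without monicity follow directly from a p-adic factorisation with
  arbitrary leading coefficients. For \<open>m\<close> = p^k the condition depends only on residues
  modulo p^k, which makes it measurable.\<close>

definition factors_mod :: "nat \<Rightarrow> nat \<Rightarrow> int \<Rightarrow> int poly \<Rightarrow> bool" where
  "factors_mod a b m f \<longleftrightarrow> (\<exists>g h. degree g \<le> a \<and> degree h \<le> b \<and> pcong m f (g * h))"

lemma zp_poly_bound: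
  assumes "zp_poly p g" "zp_nonconstant g"
  obtains a where "a \<ge> 1" "g a \<noteq> zp_zero" "\<And>i. i > a \<Longrightarrow> g i = zp_zero"
proof -
  obtain N where N: "\<And>i. i > N \<Longrightarrow> g i = zp_zero" using assms(1) unfolding zp_poly_def by blast
  obtain i where i: "i \<ge> 1" "g i \<noteq> zp_zero" using assms(2) unfolding zp_nonconstant_def by blast
  have "\<And>j. g j \<noteq> zp_zero \<Longrightarrow> j \<le> N" using N not_le by blast
  then obtain a where a: "g a \<noteq> zp_zero" "\<And>j. g j \<noteq> zp_zero \<Longrightarrow> j \<le> a"
    using Nat.ex_has_greatest_nat[of "\<lambda>j. g j \<noteq> zp_zero" i N] i(2) by blast
  then show ?thesis using that[of a] i by (meson le_trans not_le)
qed

context prime_modulus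
begin

text \<open>If \<open>x\<close> is nonzero modulo p^i and \<open>y\<close> modulo p^j, the product
  is nonzero at level i + j: otherwise p^i would divide \<open>x\<close> or p^j would divide
  \<open>y\<close> there.\<close>

lemma Zp_no_zero_divisors:
  assumes "x \<in> Zp p" "y \<in> Zp p" "x \<noteq> zp_zero" "y \<noteq> zp_zero"
  obtains k where "x k * y k mod int p ^ k \<noteq> 0"
proof -
  obtain i j where ij: "x i \<noteq> 0" "y j \<noteq> 0" using assms(3,4) by (auto simp: zp_zero_def fun_eq_iff)
  have "x (i + j) * y (i + j) mod int p ^ (i + j) \<noteq> 0"
  proof
    assume "x (i + j) * y (i + j) mod int p ^ (i + j) = 0"
    then have "int p ^ (i + j) dvd x (i + j) * y (i + j)" by auto
    then obtain a b where ab: "a + b = i + j" "int p ^ a dvd x (i + j)" "int p ^ b dvd y (i + j)"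
      using prime_elem_power_dvd_prod prime_p by (metis prime_imp_prime_elem prime_nat_int_transfer)
    then have "i \<le> a \<or> j \<le> b" by linarith
    then have "int p ^ i dvd x (i + j) \<or> int p ^ j dvd y (i + j)"
      using ab(2,3) by (meson dvd_trans le_imp_power_dvd)
    then show False
      using Zp_mod[OF assms(1), of i "i + j"] Zp_mod[OF assms(2), of j "i + j"] ij by auto
  qed
  then show ?thesis using that by blast
qed

text \<open>Take \<open>a\<close> to be the degree of \<open>g\<close>. Degrees add since there are
  no zero divisors, so \<open>h\<close> has degree \<open>n - a\<close>, and reading the product at
  level k gives the factorisation modulo p^k.\<close>

lemma reducible_imp_factors_mod:
  assumes c: "\<And>i. i < n \<Longrightarrow> c i \<in> Zp p"
    and g: "zp_poly p g" "zp_nonconstant g" and h: "zp_poly p h" "zp_nonconstant h"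
    and prod: "monic_poly p n c = zp_polymul p g h"
  obtains a where "a \<in> {1..<n}"
    "\<And>k. factors_mod a (n - a) (int p ^ k) (tuple_poly n (\<lambda>i. c i k))"
proof -
  obtain a where a: "a \<ge> 1" "g a \<noteq> zp_zero" "\<And>i. i > a \<Longrightarrow> g i = zp_zero"
    using zp_poly_bound[OF g] by blast
  obtain b where b: "b \<ge> 1" "h b \<noteq> zp_zero" "\<And>i. i > b \<Longrightarrow> h i = zp_zero"
    using zp_poly_bound[OF h] by blast
  have g0: "g i k = 0" if "i > a" for i k using a(3)[OF that] by (simp add: zp_zero_def)
  have h0: "h i k = 0" if "i > b" for i k using b(3)[OF that] by (simp add: zp_zero_def)
  have prod': "monic_poly p n c j k = (\<Sum>i\<le>j. g i k * h (j - i) k) mod int p ^ k" for j k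
    by (simp add: prod zp_polymul_def)
  have "g a \<in> Zp p" "h b \<in> Zp p" using g(1) h(1) by (auto simp: zp_poly_def)
  then obtain k where k: "g a k * h b k mod int p ^ k \<noteq> 0"
    using Zp_no_zero_divisors a(2) b(2) by blast
  then have "monic_poly p n c (a + b) k \<noteq> 0"
    using coeff_mult_at_bounds[of a "\<lambda>i. g i k" b "\<lambda>i. h i k"] g0 h0 prod' by simp
  then have "a + b \<le> n" by (auto simp: monic_poly_def zp_zero_def split: if_splits)
  moreover have "\<not> a + b < n"
  proof
    assume "a + b < n"
    then have "monic_poly p n c n 1 = 0"
      using coeff_mult_beyond_bounds[of a "\<lambda>i. g i 1" b "\<lambda>i. h i 1" n] g0 h0 prod' by simp
    then show False using p_gt_1 by (simp add: monic_poly_def zp_one_def)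
  qed
  ultimately have n: "n = a + b" by simp
  have "factors_mod a (n - a) (int p ^ k) (tuple_poly n (\<lambda>i. c i k))" for k
  proof -
    let ?G = "\<Sum>i\<le>a. monom (g i k) i" and ?H = "\<Sum>i\<le>b. monom (h i k) i"
    have cG: "coeff ?G i = g i k" for i using g0[of i k] by (simp add: coeff_sum not_le)
    have cH: "coeff ?H i = h i k" for i using h0[of i k] by (simp add: coeff_sum not_le)
    have "degree ?G \<le> a" by (rule degree_le) (use cG g0 in auto)
    moreover have "degree ?H \<le> n - a" by (rule degree_le) (use cH h0 n in auto)
    moreover have "pcong (int p ^ k) (tuple_poly n (\<lambda>i. c i k)) (?G * ?H)"
      unfolding pcong_iff_coeff coeff_mult cG cH
      by (simp flip: prod' add: monic_poly_eq_tuple_poly[of n c, OF c])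
    ultimately show ?thesis unfolding factors_mod_def by blast
  qed
  then show ?thesis using that[of a] a(1) b(1) n by simp
qed

text \<open>The factorisations at the different levels need not be compatible; compactness produces compatible
  ones. Consequently Hensel lifting is only needed for one fixed level at a time.\<close>

lemma factors_mod_imp_reducible:
  assumes c: "\<And>i. i < n \<Longrightarrow> c i \<in> Zp p" and a: "a \<in> {1..<n}"
    and fac: "\<And>k. factors_mod a (n - a) (int p ^ k) (tuple_poly n (\<lambda>i. c i k))"
  shows "\<not> zp_irreducible p (monic_poly p n c)"
proof -
  define b where "b = n - a"
  have n: "n = a + b" "b \<ge> 1" using a by (auto simp: b_def)
  obtain G H where GH: "\<And>k. degree (G k) \<le> a" "\<And>k. degree (H k) \<le> b"
    "\<And>k. pcong (int p ^ k) (tuple_poly n (\<lambda>i. c i k)) (G k * H k)"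
    using fac unfolding factors_mod_def b_def[symmetric] by metis
  define q where "q k m = (\<lambda>i. coeff (G m) i mod int p ^ k, \<lambda>i. coeff (H m) i mod int p ^ k)" for k m
  define r where "r k = map_prod (\<lambda>u (i::nat). u i mod int p ^ k) (\<lambda>u (i::nat). u i mod int p ^ k)" for k :: nat
  obtain y where y: "\<And>k. infinite {m. q k m = y k}" "\<And>k. r k (y (Suc k)) = y k"
  proof (rule compactness_sequence[of q r])
    fix k
    let ?B = "\<lambda>d. {u :: nat \<Rightarrow> int. \<forall>i. (i \<in> {..d} \<longrightarrow> u i \<in> {0..<int p ^ k}) \<and> (i \<notin> {..d} \<longrightarrow> u i = 0)}"
    have fB: "finite (?B d)" for d by (rule finite_set_of_finite_funs) auto
    have cB: "(\<lambda>i. coeff f i mod int p ^ k) \<in> ?B d" if "degree f \<le> d" for f d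
      using that p_gt_1 by (auto simp: coeff_eq_0)
    have "range (q k) \<subseteq> ?B a \<times> ?B b"
      using cB[OF GH(1)] cB[OF GH(2)] unfolding q_def by blast
    then show "finite (range (q k))" by (rule finite_subset) (intro finite_cartesian_product fB)
  next
    fix k m
    show "q k m = r k (q (Suc k) m)"
      by (auto simp: q_def r_def fun_eq_iff mod_mod_cancel)
  qed blast
  define g where "g i k = fst (y k) i" for i k
  define h where "h i k = snd (y k) i" for i k
  \<comment> \<open>The m-th factorisation is valid modulo p^k only for \<open>m \<ge> k\<close>;
    infinitely many m agree with \<open>y k\<close>, so such an m exists.\<close>
  have level: "\<exists>m\<ge>k. (\<forall>i. g i k = coeff (G m) i mod int p ^ k \<and> h i k = coeff (H m) i mod int p ^ k)" for k
  proof -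
    obtain m where m: "m \<ge> k" "q k m = y k"
      using y(1)[of k] by (auto simp: infinite_nat_iff_unbounded_le)
    then show ?thesis by (auto simp: g_def h_def q_def simp flip: m(2))
  qed
  have gZ: "g i \<in> Zp p" and hZ: "h i \<in> Zp p" for i
  proof -
    have "0 \<le> g i k \<and> g i k < int p ^ k" "0 \<le> h i k \<and> h i k < int p ^ k" for k
      using level[of k] p_gt_1 by auto
    moreover have "g i (Suc k) mod int p ^ k = g i k" "h i (Suc k) mod int p ^ k = h i k" for k
      unfolding g_def h_def by (simp_all add: r_def flip: y(2)[of k])
    ultimately show "g i \<in> Zp p" "h i \<in> Zp p" by (auto simp: Zp_def)
  qed
  have g0: "g i k = 0" if "i > a" for i k
    using level[of k] coeff_eq_0[OF le_less_trans[OF GH(1) that]] by auto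
  have h0: "h i k = 0" if "i > b" for i k
    using level[of k] coeff_eq_0[OF le_less_trans[OF GH(2) that]] by auto
  have prod: "monic_poly p n c j k = (\<Sum>i\<le>j. g i k * h (j - i) k) mod int p ^ k" for j k
  proof -
    obtain m where m: "m \<ge> k" "\<And>i. g i k = coeff (G m) i mod int p ^ k"
      "\<And>i. h i k = coeff (H m) i mod int p ^ k" using level by blast
    have "pcong (int p ^ k) (tuple_poly n (\<lambda>i. c i k)) (tuple_poly n (\<lambda>i. c i m))"
      using pcong_tuple_poly_level[of n c p k m, OF c m(1)] by (rule pcong_sym)
    also have "pcong (int p ^ k) (tuple_poly n (\<lambda>i. c i m)) (G m * H m)"
      using GH(3) by (rule pcong_mod_dvd) (simp add: le_imp_power_dvd m(1))
    finally have "monic_poly p n c j k = coeff (G m * H m) j mod int p ^ k"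
      by (simp add: monic_poly_eq_tuple_poly[of n c, OF c] pcong_iff_coeff)
    also have "\<dots> = (\<Sum>i\<le>j. (coeff (G m) i * coeff (H m) (j - i)) mod int p ^ k) mod int p ^ k"
      by (simp add: coeff_mult mod_sum_eq)
    also have "\<dots> = (\<Sum>i\<le>j. (g i k * h (j - i) k) mod int p ^ k) mod int p ^ k"
      by (simp add: m(2,3) mod_mult_eq)
    finally show ?thesis by (simp add: mod_sum_eq)
  qed
  \<comment> \<open>The coefficient of x^n is 1 modulo p, so both degree bounds are attained and
    neither factor is constant.\<close>
  have "g a 1 * h b 1 mod int p = 1"
    using prod[of n 1] coeff_mult_at_bounds[of a "\<lambda>i. g i 1" b "\<lambda>i. h i 1"] g0 h0 n p_gt_1
    by (simp add: monic_poly_def zp_one_def)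
  then have "g a \<noteq> zp_zero" "h b \<noteq> zp_zero" by (auto simp: zp_zero_def)
  then have "zp_nonconstant g" "zp_nonconstant h"
    using a n(2) unfolding zp_nonconstant_def by auto
  moreover have "zp_poly p g" "zp_poly p h"
    using gZ hZ g0 h0 unfolding zp_poly_def zp_zero_def by blast+
  moreover have "monic_poly p n c = zp_polymul p g h"
    by (intro ext) (simp add: prod zp_polymul_def)
  ultimately show ?thesis unfolding zp_irreducible_def by blast
qed

text \<open>This trades the quantifiers over p-adic factors for countably many conditions on
  residues, as needed both for measurability and for passing between irreducibility and
  residues.\<close>

lemma zp_irreducible_iff:
  assumes "\<And>i. i < n \<Longrightarrow> c i \<in> Zp p"
  shows "zp_irreducible p (monic_poly p n c) \<longleftrightarrow>
    \<not> (\<exists>a\<in>{1..<n}. \<forall>k. factors_mod a (n - a) (int p ^ k) (tuple_poly n (\<lambda>i. c i k)))"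
proof
  assume "zp_irreducible p (monic_poly p n c)"
  then show "\<not> (\<exists>a\<in>{1..<n}. \<forall>k. factors_mod a (n - a) (int p ^ k) (tuple_poly n (\<lambda>i. c i k)))"
    using factors_mod_imp_reducible[of n c] assms by blast
next
  assume *: "\<not> (\<exists>a\<in>{1..<n}. \<forall>k. factors_mod a (n - a) (int p ^ k) (tuple_poly n (\<lambda>i. c i k)))"
  show "zp_irreducible p (monic_poly p n c)"
    unfolding zp_irreducible_def
  proof clarify
    fix g h assume "zp_poly p g" "zp_poly p h" "zp_nonconstant g" "zp_nonconstant h"
      "monic_poly p n c = zp_polymul p g h"
    then show False using reducible_imp_factors_mod[of n c g h] assms * by metis
  qed
qed

text \<open>A factorisation modulo \<open>p\<close> within the degree bounds has top coefficients
  \<open>x\<close> and \<open>y\<close> with x y = 1 modulo \<open>p\<close>. Scaling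
  \<open>g\<close> by \<open>y\<close> and \<open>h\<close> by \<open>x\<close> keeps the product
  and makes both factors monic of degrees \<open>a\<close> and \<open>n - a\<close>, against
  irreducibility.\<close>

lemma irreducible_of_irred_residue:
  assumes c: "\<And>i. i < n \<Longrightarrow> c i \<in> Zp p" and irr: "mirred p (tuple_poly n (\<lambda>i. c i 1))"
  shows "zp_irreducible p (monic_poly p n c)"
proof (rule ccontr)
  let ?F = "tuple_poly n (\<lambda>i. c i 1)"
  assume "\<not> ?thesis"
  then obtain a where a: "a \<in> {1..<n}"
    "\<And>k. factors_mod a (n - a) (int p ^ k) (tuple_poly n (\<lambda>i. c i k))"
    using zp_irreducible_iff[of n c, OF c] by blast
  obtain g h where gh: "degree g \<le> a" "degree h \<le> n - a" "pcong (int p) ?F (g * h)"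
    using a(2)[of 1] unfolding factors_mod_def by auto
  define x y where "x = coeff g a" and "y = coeff h (n - a)"
  have "coeff (g * h) (a + (n - a)) = x * y"
    unfolding coeff_mult x_def y_def
    by (rule coeff_mult_at_bounds) (use gh in \<open>auto simp: coeff_eq_0\<close>)
  then have xy: "x * y mod int p = 1"
    using gh(3) a(1) p_gt_1 unfolding pcong_iff_coeff coeff_tuple_poly
    by (auto dest!: spec[of _ n])
  have monic: "lead_coeff (reduce_poly (int p) (smult z f)) = 1 \<and> degree (reduce_poly (int p) (smult z f)) = d"
    if "degree f \<le> d" "z * coeff f d mod int p = 1" for z f d
  proof -
    have "coeff (reduce_poly (int p) (smult z f)) d = 1" using that(2) by simp
    moreover have "degree (reduce_poly (int p) (smult z f)) \<le> d"
      using degree_reduce_poly_le[of "int p" "smult z f"] degree_smult_le[of z f] that(1) by linarith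
    ultimately show ?thesis by (metis antisym le_degree zero_neq_one)
  qed
  let ?g = "reduce_poly (int p) (smult y g)" and ?h = "reduce_poly (int p) (smult x h)"
  have g': "lead_coeff ?g = 1 \<and> degree ?g = a"
    using monic[OF gh(1)] xy by (simp add: x_def mult.commute)
  have h': "lead_coeff ?h = 1 \<and> degree ?h = n - a"
    using monic[OF gh(2)] xy by (simp add: y_def)
  have "pcong (int p) [:x * y:] 1"
    using xy p_gt_1 by (auto simp: pcong_iff_coeff coeff_pCons split: nat.split)
  then have "pcong (int p) (g * h * [:x * y:]) (g * h * 1)" by (rule pcong_mult_left)
  then have "pcong (int p) ?F (g * h * [:x * y:])" using gh(3) by (metis mult.right_neutral pcong_sym pcong_trans)
  also have "g * h * [:x * y:] = smult y g * smult x h" by (simp add: mult.commute)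
  also have "pcong (int p) \<dots> (?g * ?h)" by (intro pcong_mult pcong_reduce_poly)
  finally have "pcong (int p) ?F (?g * ?h)" .
  from mirredD[OF irr this conjunct1[OF g'] conjunct1[OF h']]
  show False using g' h' a(1) by auto
qed

text \<open>Otherwise the residue splits into coprime nonconstant monic factors, and Hensel lifting
  gives factors of the same degrees modulo every p^k.\<close>

lemma prime_power_residue_of_irreducible:
  assumes c: "\<And>i. i < n \<Longrightarrow> c i \<in> Zp p" and n: "n \<ge> 1"
    and irr: "zp_irreducible p (monic_poly p n c)"
  shows "\<exists>(P, k)\<in>prime_powers_deg n. pcong (int p) (tuple_poly n (\<lambda>i. c i 1)) (P ^ k)"
proof -
  let ?F = "\<lambda>k. tuple_poly n (\<lambda>i. c i k)"
  show ?thesis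
  proof (rule prime_power_or_coprime_factors[OF lead_coeff_tuple_poly degree_tuple_poly n])
    fix g h assume gh: "lead_coeff g = 1" "lead_coeff h = 1" "degree g \<ge> 1" "degree h \<ge> 1"
      "mcoprime p g h" "pcong (int p) (?F 1) (g * h)"
    have "h \<noteq> 0" using gh(2) by auto
    then have deg: "n = degree g + degree h"
      using pcong_monic_degree[OF gh(6) lead_coeff_tuple_poly lead_coeff_monic_mult[OF gh(1,2)]]
        degree_monic_mult[OF gh(1)] by simp
    have "factors_mod (degree g) (n - degree g) (int p ^ k) (?F k)" for k
    proof (cases k)
      case 0
      \<comment> \<open>At k = 0 the modulus is 1 and any two polynomials are congruent; Hensel
        lifting covers exponents from 1 on.\<close>
      have "pcong 1 (?F k) (0 * 0)" by (simp add: pcong_iff_coeff)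
      then show ?thesis using 0 unfolding factors_mod_def by (metis degree_0 le0 power_0)
    next
      case (Suc m)
      have "pcong (int p) (?F k) (?F 1)" using pcong_tuple_poly_level[of n c p 1 k, OF c] Suc by simp
      then have "pcong (int p) (?F k) (g * h)" using gh(6) by (rule pcong_trans)
      then show ?thesis
        using hensel_lift[OF lead_coeff_tuple_poly gh(1,2,5), of n "\<lambda>i. c i k" m] Suc deg
        unfolding factors_mod_def by (metis add_diff_cancel_left' order.refl)
    qed
    moreover have "degree g \<in> {1..<n}" using gh(3,4) deg by auto
    ultimately show ?thesis using zp_irreducible_iff[of n c, OF c] irr by blast
  qed auto
qed

end

section \<open>Haar measure\<close>

lemma tuple_poly_cong: "(\<And>i. i < n \<Longrightarrow> u i = v i) \<Longrightarrow> tuple_poly n u = tuple_poly n v"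
  by (simp add: tuple_poly_def)

lemma zp_of_digits_bounds:
  assumes "\<And>i. d i < p"
  shows "0 \<le> zp_of_digits p d k \<and> zp_of_digits p d k < int p ^ k"
proof (induction k)
  case (Suc k)
  have "0 \<le> int (d k) * int p ^ k" by simp
  moreover have "(int (d k) + 1) * int p ^ k \<le> int p * int p ^ k"
    using assms[of k] by (intro mult_right_mono) auto
  ultimately show ?case using Suc by (simp add: zp_of_digits_def algebra_simps)
qed (simp add: zp_of_digits_def)

lemma zp_of_digits_in_Zp:
  assumes "\<And>i. d i < p"
  shows "zp_of_digits p d \<in> Zp p"
proof -
  have "zp_of_digits p d (Suc k) mod int p ^ k = zp_of_digits p d k" for k
  proof -
    have "zp_of_digits p d (Suc k) = zp_of_digits p d k + int (d k) * int p ^ k"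
      by (simp add: zp_of_digits_def)
    then show ?thesis using zp_of_digits_bounds[of d p k, OF assms] by simp
  qed
  then show ?thesis using zp_of_digits_bounds[of d p, OF assms] by (simp add: Zp_def)
qed

lemma space_haar_Zp: "space (haar_Zp p) = Zp p"
  by (simp add: haar_Zp_def space_restrict_space space_PiM)

lemma measurable_Zp_level: "(\<lambda>x. x k) \<in> measurable (haar_Zp p) (count_space UNIV)"
proof -
  have "(\<lambda>x. x k) \<in> measurable (restrict_space (PiM UNIV (\<lambda>_::nat. count_space (UNIV::int set))) (Zp p))
      (count_space UNIV)"
    by (intro measurable_restrict_space1 measurable_component_singleton) auto
  then show ?thesis unfolding haar_Zp_def measurable_distr_eq1 .
qed

lemma sets_Zp_level: "{x \<in> Zp p. x k = v} \<in> sets (haar_Zp p)"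
  using measurable_sets[OF measurable_Zp_level, of "{v}" k p]
  by (simp add: space_haar_Zp vimage_def Int_def conj_commute)

section \<open>The digit measure on Z_p\<close>

context prime_modulus
begin

abbreviation digit_space :: "(nat \<Rightarrow> nat) measure" where
  "digit_space \<equiv> PiM UNIV (\<lambda>_::nat. uniform_count_measure {0..<p})"

lemma space_digit_space: "space digit_space = {d. \<forall>i. d i < p}"
  by (auto simp: space_PiM PiE_def Pi_def space_uniform_count_measure)

lemma prob_space_digit: "prob_space (uniform_count_measure {0..<p})"
  using prime_gt_0_nat[OF prime_p] by (intro prob_space_uniform_count_measure) auto

lemma measurable_zp_of_digits:
  "zp_of_digits p \<in> measurable digit_space
     (restrict_space (PiM UNIV (\<lambda>_::nat. count_space (UNIV::int set))) (Zp p))"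
proof (rule measurable_restrict_space2)
  show "zp_of_digits p \<in> space digit_space \<rightarrow> Zp p"
    unfolding space_digit_space using zp_of_digits_in_Zp by auto
  have digit: "(\<lambda>d. f (d i)) \<in> measurable digit_space (count_space UNIV)"
    for i and f :: "nat \<Rightarrow> int"
  proof -
    have "(\<lambda>d. d i) \<in> measurable digit_space (uniform_count_measure {0..<p})"
      by (rule measurable_component_singleton) simp
    moreover have "f \<in> measurable (uniform_count_measure {0..<p}) (count_space UNIV)"
      by (simp add: measurable_def sets_uniform_count_measure space_uniform_count_measure)
    ultimately show ?thesis by (rule measurable_compose)
  qed
  have level: "(\<lambda>d. zp_of_digits p d k) \<in> measurable digit_space (count_space UNIV)" for k
  proof (induction k)
    case 0
    then show ?case by (simp add: zp_of_digits_def)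
  next
    case (Suc k)
    \<comment> \<open>The partial sum takes countably many values, so it can be held fixed, leaving
      a function of the single digit \<open>d k\<close>.\<close>
    have "(\<lambda>d. zp_of_digits p d k + int (d k) * int p ^ k) \<in> measurable digit_space (count_space UNIV)"
      by (rule measurable_compose_countable[OF _ Suc]) (rule digit)
    then show ?case by (simp add: zp_of_digits_def)
  qed
  have "(\<lambda>d k. zp_of_digits p d k) \<in> measurable digit_space (PiM UNIV (\<lambda>_::nat. count_space UNIV))"
    by (rule measurable_PiM_single') (use level in auto)
  then show "zp_of_digits p \<in> measurable digit_space (PiM UNIV (\<lambda>_::nat. count_space UNIV))" by simp
qed

lemma prob_space_haar_Zp: "prob_space (haar_Zp p)"
  unfolding haar_Zp_def
  by (intro prob_space.prob_space_distr measurable_zp_of_digits prob_space_PiM prob_space_digit)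

text \<open>The residue modulo \<open>p\<close> is the lowest digit, which is uniform on p
  values.\<close>

lemma measure_Zp_residue:
  assumes "v \<in> {0..<int p}"
  shows "measure (haar_Zp p) {x \<in> Zp p. x 1 = v} = 1 / p"
proof -
  interpret product_prob_space "\<lambda>_::nat. uniform_count_measure {0..<p}" UNIV
    by (intro product_prob_spaceI prob_space_digit)
  have "measure (haar_Zp p) {x \<in> Zp p. x 1 = v}
      = measure digit_space (zp_of_digits p -` {x \<in> Zp p. x 1 = v} \<inter> space digit_space)"
    using sets_Zp_level[of p 1 v] unfolding haar_Zp_def
    by (intro measure_distr measurable_zp_of_digits) simp
  also have "zp_of_digits p -` {x \<in> Zp p. x 1 = v} \<inter> space digit_space
      = (\<lambda>d. d 0) -` {nat v} \<inter> space digit_space"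
    using assms zp_of_digits_in_Zp by (auto simp: space_digit_space zp_of_digits_def)
  also have "measure digit_space \<dots> = measure (distr digit_space (uniform_count_measure {0..<p}) (\<lambda>d. d 0)) {nat v}"
    by (rule measure_distr[symmetric])
      (use assms in \<open>auto simp: sets_uniform_count_measure intro: measurable_component_singleton\<close>)
  also have "\<dots> = measure (uniform_count_measure {0..<p}) {nat v}"
    by (subst PiM_component) auto
  also have "\<dots> = 1 / p"
    using assms by (subst measure_uniform_count_measure) auto
  finally show ?thesis .
qed

section \<open>Events determined by residues modulo p^k\<close>

lemma space_haar_Zp_n: "space (haar_Zp_n p n) = {..<n} \<rightarrow>\<^sub>E Zp p"
  by (simp add: haar_Zp_n_def space_PiM space_haar_Zp)

text \<open>A finite union of boxes, one per admissible tuple of residues; this yields measurability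
  at every level and the measure at level 1.\<close>

lemma level_event_eq:
  "{c \<in> space (haar_Zp_n p n). Q (tuple_poly n (\<lambda>i. c i k))}
    = (\<Union>v\<in>{v \<in> {..<n} \<rightarrow>\<^sub>E {0..<int p ^ k}. Q (tuple_poly n v)}. \<Pi>\<^sub>E i\<in>{..<n}. {x \<in> Zp p. x k = v i})"
  (is "?L = ?R")
proof (intro set_eqI iffI)
  fix c assume "c \<in> ?L"
  then have c: "c \<in> {..<n} \<rightarrow>\<^sub>E Zp p" "Q (tuple_poly n (\<lambda>i. c i k))" by (auto simp: space_haar_Zp_n)
  let ?v = "restrict (\<lambda>i. c i k) {..<n}"
  have "tuple_poly n ?v = tuple_poly n (\<lambda>i. c i k)" by (rule tuple_poly_cong) simp
  moreover have "?v \<in> {..<n} \<rightarrow>\<^sub>E {0..<int p ^ k}" using c(1) by (auto simp: PiE_iff Zp_def)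
  moreover have "c \<in> (\<Pi>\<^sub>E i\<in>{..<n}. {x \<in> Zp p. x k = ?v i})" using c(1) by (auto simp: PiE_iff)
  ultimately show "c \<in> ?R" using c(2) by (intro UN_I[of ?v]) auto
next
  fix c assume "c \<in> ?R"
  then obtain v where v: "Q (tuple_poly n v)" "c \<in> (\<Pi>\<^sub>E i\<in>{..<n}. {x \<in> Zp p. x k = v i})" by auto
  then have "tuple_poly n (\<lambda>i. c i k) = tuple_poly n v" by (intro tuple_poly_cong) (auto simp: PiE_iff)
  then show "c \<in> ?L" using v by (auto simp: space_haar_Zp_n PiE_iff)
qed

lemma sets_level_box: "(\<Pi>\<^sub>E i\<in>{..<n}. {x \<in> Zp p. x k = v i}) \<in> sets (haar_Zp_n p n)"
  unfolding haar_Zp_n_def by (intro sets_PiM_I_finite sets_Zp_level) auto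

lemma sets_level_event:
  "{c \<in> space (haar_Zp_n p n). Q (tuple_poly n (\<lambda>i. c i k))} \<in> sets (haar_Zp_n p n)"
  unfolding level_event_eq
  by (intro sets.finite_UN sets_level_box finite_subset[OF Collect_restrict] finite_PiE) auto

lemma prob_space_haar_Zp_n: "prob_space (haar_Zp_n p n)"
  unfolding haar_Zp_n_def by (intro prob_space_PiM prob_space_haar_Zp)

text \<open>The boxes are disjoint, each has measure p^(-n) by the product measure, and
  \<open>tuple_poly\<close> matches them with the monic residue classes satisfying
  \<open>Q\<close>.\<close>

lemma measure_residue_event:
  "measure (haar_Zp_n p n) {c \<in> space (haar_Zp_n p n). Q (tuple_poly n (\<lambda>i. c i 1))}
    = card {f \<in> monics p n. Q f} / p ^ n"
proof -
  interpret product_prob_space "\<lambda>_. haar_Zp p" "{..<n}"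
    by (rule product_prob_spaceI) (rule prob_space_haar_Zp)
  interpret finite_product_prob_space "\<lambda>_. haar_Zp p" "{..<n}"
    by unfold_locales (rule finite_lessThan)
  interpret H: prob_space "haar_Zp_n p n" by (rule prob_space_haar_Zp_n)
  let ?V = "{v \<in> {..<n} \<rightarrow>\<^sub>E {0..<int p}. Q (tuple_poly n v)}"
  let ?B = "\<lambda>v. \<Pi>\<^sub>E i\<in>{..<n}. {x \<in> Zp p. x 1 = v i}"
  have box: "measure (haar_Zp_n p n) (?B v) = (1 / p) ^ n" if "v \<in> ?V" for v
  proof -
    have "measure (haar_Zp_n p n) (?B v) = (\<Prod>i<n. measure (haar_Zp p) {x \<in> Zp p. x 1 = v i})"
      unfolding haar_Zp_n_def by (rule prob_times) (rule sets_Zp_level)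
    also have "\<dots> = (\<Prod>i<n. 1 / p)"
    proof (rule prod.cong[OF refl])
      fix i assume "i \<in> {..<n}"
      with that have "v i \<in> {0..<int p}" by (simp add: PiE_iff)
      then show "measure (haar_Zp p) {x \<in> Zp p. x 1 = v i} = 1 / p" by (rule measure_Zp_residue)
    qed
    finally show ?thesis by simp
  qed
  have disj: "disjoint_family_on ?B ?V"
    unfolding disjoint_family_on_def
  proof (intro ballI impI)
    fix u v assume uv: "u \<in> ?V" "v \<in> ?V" "u \<noteq> v"
    from uv(3) obtain i where i: "u i \<noteq> v i" by (auto simp: fun_eq_iff)
    have "i < n"
    proof (rule ccontr)
      assume "\<not> i < n"
      then have "u i = undefined" "v i = undefined"
        using uv(1,2) by (auto dest: PiE_arb)
      with i show False by simp
    qed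
    show "?B u \<inter> ?B v = {}"
    proof (rule equals0I)
      fix c assume "c \<in> ?B u \<inter> ?B v"
      then have "c i 1 = u i" "c i 1 = v i" using \<open>i < n\<close> by (auto dest: PiE_mem)
      with i show False by simp
    qed
  qed
  have "{c \<in> space (haar_Zp_n p n). Q (tuple_poly n (\<lambda>i. c i 1))} = (\<Union>v\<in>?V. ?B v)"
    using level_event_eq[of n Q 1] by simp
  also have "measure (haar_Zp_n p n) \<dots> = (\<Sum>v\<in>?V. measure (haar_Zp_n p n) (?B v))"
    by (rule H.finite_measure_finite_Union)
      (use disj sets_level_box in \<open>auto intro!: finite_subset[OF Collect_restrict] finite_PiE\<close>)
  also have "\<dots> = card ?V * (1 / p) ^ n" using box by simp
  also have "card ?V = card {f \<in> monics p n. Q f}"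
  proof (rule bij_betw_same_card[of "tuple_poly n"])
    have "bij_betw (tuple_poly n) ?V (tuple_poly n ` ?V)"
      by (rule bij_betw_subset[OF bij_betw_tuple_poly[of n]]) auto
    moreover have "tuple_poly n ` ?V = {f \<in> monics p n. Q f}"
      using bij_betw_imp_surj_on[OF bij_betw_tuple_poly[of n]] by auto
    ultimately show "bij_betw (tuple_poly n) ?V {f \<in> monics p n. Q f}" by simp
  qed
  finally show ?thesis by (simp add: power_one_over)
qed

lemma Zp_of_space: "c \<in> space (haar_Zp_n p n) \<Longrightarrow> i < n \<Longrightarrow> c i \<in> Zp p"
  by (auto simp: space_haar_Zp_n)

text \<open>This is indispensable: \<open>measure\<close> returns the junk value 0 on nonmeasurable sets.\<close>

lemma sets_irreducible:
  "{c \<in> space (haar_Zp_n p n). zp_irreducible p (monic_poly p n c)} \<in> sets (haar_Zp_n p n)"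
proof -
  let ?M = "haar_Zp_n p n"
  let ?R = "\<lambda>c. \<exists>a\<in>{1..<n}. \<forall>k. factors_mod a (n - a) (int p ^ k) (tuple_poly n (\<lambda>i. c i k))"
  have "{c \<in> space ?M. \<not> ?R c} \<in> sets ?M"
    by (intro sets.sets_Collect_neg sets.sets_Collect_finite_Ex sets.sets_Collect_countable_All
        sets_level_event) simp
  also have "{c \<in> space ?M. \<not> ?R c} = {c \<in> space ?M. zp_irreducible p (monic_poly p n c)}"
  proof (intro Collect_cong conj_cong refl)
    fix c assume "c \<in> space ?M"
    then show "\<not> ?R c \<longleftrightarrow> zp_irreducible p (monic_poly p n c)"
      using zp_irreducible_iff[of n c] Zp_of_space[of c n] by simp
  qed
  finally show ?thesis .
qed

text \<open>The irreducible set lies between two residue events: it contains the polynomials with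
  irreducible residue and is contained in those whose residue is a prime power.\<close>

lemma irred_proportion_bounds:
  assumes "n \<ge> 1"
  defines "N \<equiv> card {P \<in> irreds p. degree P = n}"
  shows "N / p ^ n \<le> irred_proportion n p"
    and "irred_proportion n p \<le> (N + n * p ^ (n div 2)) / p ^ n"
proof -
  let ?M = "haar_Zp_n p n"
  interpret prob_space ?M by (rule prob_space_haar_Zp_n)
  let ?A = "{c \<in> space ?M. zp_irreducible p (monic_poly p n c)}"
  let ?E = "\<lambda>Q. {c \<in> space ?M. Q (tuple_poly n (\<lambda>i. c i 1))}"
  let ?Q = "\<lambda>f. \<exists>(P, k)\<in>prime_powers_deg n. pcong (int p) f (P ^ k)"
  have "{f \<in> monics p n. mirred p f} = {P \<in> irreds p. degree P = n}"
    by (auto simp: irreds_def monics_def)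
  then have "N / p ^ n = measure ?M (?E (mirred p))"
    by (simp only: measure_residue_event N_def)
  also have "\<dots> \<le> measure ?M ?A"
  proof (rule finite_measure_mono[OF _ sets_irreducible], clarify)
    fix c assume "c \<in> space ?M" "mirred p (tuple_poly n (\<lambda>i. c i 1))"
    then show "zp_irreducible p (monic_poly p n c)"
      using irreducible_of_irred_residue[of n c] Zp_of_space by blast
  qed
  finally show "N / p ^ n \<le> irred_proportion n p" by (simp add: irred_proportion_def)
  have "measure ?M ?A \<le> measure ?M (?E ?Q)"
  proof (rule finite_measure_mono[OF _ sets_level_event], intro subsetI CollectI conjI)
    fix c assume c: "c \<in> ?A"
    then show "c \<in> space ?M" by simp
    show "?Q (tuple_poly n (\<lambda>i. c i 1))"
      by (rule prime_power_residue_of_irreducible[OF Zp_of_space[of c] assms(1)]) (use c in auto)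
  qed
  also have "\<dots> = card {f \<in> monics p n. ?Q f} / p ^ n" by (rule measure_residue_event)
  also have "\<dots> \<le> (N + n * p ^ (n div 2)) / p ^ n"
    using card_prime_powers[of n] unfolding N_def
    by (intro divide_right_mono) (simp_all only: of_nat_le_iff of_nat_0_le_iff zero_le_power)
  finally show "irred_proportion n p \<le> (N + n * p ^ (n div 2)) / p ^ n"
    by (simp add: irred_proportion_def)
qed

end

theorem theorem1:
  fixes n :: nat
  assumes "n \<ge> 1"
  shows "\<exists>C>0. \<forall>p::nat. prime p \<and> \<not> p dvd n \<longrightarrow>
           \<bar>irred_proportion n p - 1 / real n\<bar> \<le> C * real p powr (- (real n / 2))"
proof (intro exI[of _ "real n"] conjI allI impI)
  show "real n > 0" using assms by simp
  fix p :: nat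
  assume "prime p \<and> \<not> p dvd n"
  then interpret prime_modulus p by unfold_locales simp
  define N where "N = card {P \<in> irreds p. degree P = n}"
  have p0: "real p > 1" using p_gt_1 by simp
  \<comment> \<open>Both 1/n and the proportion lie between N / p^n and N / p^n + n e, which gives
    the constant n; and e is at most p^(-n/2) because \<open>n div 2\<close> is at most n/2.\<close>
  define e where "e = real p ^ (n div 2) / real p ^ n"
  have "e = real p powr (real (n div 2) - real n)"
    using p0 by (simp add: e_def powr_diff powr_realpow)
  also have "\<dots> \<le> real p powr (- (real n / 2))"
    using p0 by (intro powr_mono) auto
  finally have e: "e \<le> real p powr (- (real n / 2))" .
  have "real n * real N \<le> real p ^ n" "real p ^ n \<le> real n * real N + real n * (real n * real p ^ (n div 2))"
    using card_irreds_bounds[OF assms] unfolding N_def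
    by (simp_all flip: of_nat_power of_nat_mult of_nat_add)
  then have N: "N / p ^ n \<le> 1 / n" "1 / n \<le> N / p ^ n + n * e"
    using assms p0 by (auto simp: e_def field_simps)
  have "N / p ^ n \<le> irred_proportion n p" "irred_proportion n p \<le> N / p ^ n + n * e"
    using irred_proportion_bounds[OF assms] unfolding N_def e_def by (auto simp: add_divide_distrib)
  with N have "\<bar>irred_proportion n p - 1 / real n\<bar> \<le> n * e" by linarith
  also have "\<dots> \<le> real n * real p powr (- (real n / 2))" using e by (intro mult_left_mono) auto
  finally show "\<bar>irred_proportion n p - 1 / real n\<bar> \<le> real n * real p powr (- (real n / 2))" .
qed

end
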